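(* Let $\mathsf H$ be a quaternionic Hilbert space, $\imath\in\mathbb S$, let $T\in\mathfrak B(\mathsf H)$ be a normal operator and let $\mathcal P=(P,\mathcal L)$ be an iqPVM over $\mathbb C_\imath^+$ in $\mathsf H$, with $\mathrm{supp}(P)$ bounded, satisfying $T=\int_{\mathbb C_\imath^+}\mathit{id}\,d\mathcal P$, where $\mathit{id}:\mathbb C_\imath^+\hookrightarrow\mathbb H$ is the inclusion. Let $\Gamma=\mathrm{supp}(P)$. Then there exist a family $\{\nu_\alpha\}_{\alpha\in\mathcal A}$ of positive $\sigma$-additive finite Borel measures over $\Gamma$ and an isometry $V:\mathsf H\to\bigoplus_{\alpha\in\mathcal A}L^2(\Gamma,\mathbb H;\nu_\alpha)$ such that, for every bounded Borel measurable $\varphi:\Gamma\to\mathbb H$, the operator $\varphi(T):=\int_{\mathbb C_\imath^+}\varphi\,d\mathcal P$ satisfies $$(V\varphi(T)V^{-1})(\oplus_{\alpha\in\mathcal A}f_\alpha)=\oplus_{\alpha\in\mathcal A}\,\varphi f_\alpha\qquad\nu_\alpha\text{-a.e. in }\Gamma,$$ where $\varphi f_\alpha$ is the pointwise product. In particular, if $L_q:=\mathcal L(q)$ for $q\in\mathbb H$, then $$(VL_qV^{-1})(\oplus_{\alpha\in\mathcal A}f_\alpha)=\oplus_{\alpha\in\mathcal A}\,qf_\alpha\qquad\nu_\alpha\text{-a.e. in }\Gamma.$$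
   Context: $\mathbb H$ denotes the quaternions, $\mathbb S=\{q\in\mathbb H: q^2=-1\}$. For $\imath\in\mathbb S$, $\mathbb C_\imath^+=\{\alpha+\imath\beta:\alpha,\beta\in\mathbb R,\ \beta\ge0\}$, with Euclidean topology and Borel $\sigma$-algebra $\mathscr B(\mathbb C_\imath^+)$. A quaternionic Hilbert space $\mathsf H$ is a non-zero right $\mathbb H$-module with an additive $\mathbb H$-valued product satisfying $\langle u|vp+wq\rangle=\langle u|v\rangle p+\langle u|w\rangle q$, $\langle u|v\rangle=\overline{\langle v|u\rangle}$, $\langle u|u\rangle\ge0$, such that $\|u\|=\sqrt{\langle u|u\rangle}$ is a complete norm. Operators are right $\mathbb H$-linear; $\mathfrak B(\mathsf H)$ is the set of bounded operators $\mathsf H\to\mathsf H$; $T$ is normal if $TT^*=T^*T$. An isometry between quaternionic Hilbert spaces is a bijective, right $\mathbb H$-linear, norm-preserving map. Left scalar multiplication of $\mathsf H$: a map $\mathcal L:\mathbb H\to\mathfrak B(\mathsf H)$, $\mathcal L(q)=L_q$, of the form $L_qu=\sum_{z\in N}zq\langle z|u\rangle$ for some Hilbert (orthonormal, total) basis $N$ of $\mathsf H$. qPVM over $\mathbb C_\imath^+$ in $\mathsf H$: a map $P:\mathscr B(\mathbb C_\imath^+)\to\mathfrak B(\mathsf H)$ with $P(E)\ge0$, $P(\mathbb C_\imath^+)=I$, $P(E)P(E')=P(E\cap E')$, and $\sum_nP(E_n)u=P(\bigcup_nE_n)u$ for all $u\in\mathsf H$ and all countable families of pairwise disjoint Borel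 sets. $\mathrm{supp}(P)$ is the complement of the union of all open $O\subset\mathbb C_\imath^+$ with $P(O)=0$. An iqPVM is a pair $\mathcal P=(P,\mathcal L)$ with $P$ a qPVM and $\mathcal L$ a left scalar multiplication with $P(E)L_q=L_qP(E)$ for all $E$, $q$. Integral: for a simple function $s=\sum_\ell S_\ell\chi_{E_\ell}$ ($S_\ell\in\mathbb H$, $E_\ell$ disjoint Borel), $\int s\,d\mathcal P=\sum_\ell L_{S_\ell}P(E_\ell)$; for bounded Borel $\varphi:\mathbb C_\imath^+\to\mathbb H$, $\int\varphi\,d\mathcal P$ is the norm limit of $\int s_n\,d\mathcal P$ for simple $s_n\to\varphi$ uniformly. If $\psi$ is $\mathbb H$-valued and bounded and Borel on $\Gamma=\mathrm{supp}(P)$, $\int_{\mathbb C_\imath^+}\psi\,d\mathcal P$ is the integral of the function equal to $\psi$ on $\Gamma$ and $0$ elsewhere. For a positive measure $\nu$ on $\Gamma$, $L^2(\Gamma,\mathbb H;\nu)$ is the quaternionic Hilbert space of (classes of) measurable $f:\Gamma\to\mathbb H$ with $\int|f|^2d\nu<\infty$, with pointwise right scalar multiplication and $\langle f|g\rangle=\int\overline f g\,d\nu$ (componentwise integral). $\bigoplus$ is the Hilbert direct sum. *)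

theory Defs
  imports "HOL-Analysis.Analysis"
begin

section \<open>Quaternions\<close>

datatype quat = Quat (qRe: real) (qI: real) (qJ: real) (qK: real)

lemma quat_eq_iff: "p = q \<longleftrightarrow> qRe p = qRe q \<and> qI p = qI q \<and> qJ p = qJ q \<and> qK p = qK q"
  by (cases p; cases q) simp

instantiation quat :: ring_1
begin

definition "0 = Quat 0 0 0 0"
definition "1 = Quat 1 0 0 0"
definition "p + q = Quat (qRe p + qRe q) (qI p + qI q) (qJ p + qJ q) (qK p + qK q)"
definition "- p = Quat (- qRe p) (- qI p) (- qJ p) (- qK p)"
definition "p - q = Quat (qRe p - qRe q) (qI p - qI q) (qJ p - qJ q) (qK p - qK q)"
definition "p * q = Quat
  (qRe p * qRe q - qI p * qI q - qJ p * qJ q - qK p * qK q)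
  (qRe p * qI q + qI p * qRe q + qJ p * qK q - qK p * qJ q)
  (qRe p * qJ q - qI p * qK q + qJ p * qRe q + qK p * qI q)
  (qRe p * qK q + qI p * qJ q - qJ p * qI q + qK p * qRe q)"

lemmas quat_arith_defs =
  zero_quat_def one_quat_def plus_quat_def uminus_quat_def minus_quat_def times_quat_def

instance
  by standard (simp_all add: quat_arith_defs algebra_simps)

end

lemma quat_sel_simps [simp]:
  "qRe 0 = 0" "qI 0 = 0" "qJ 0 = 0" "qK 0 = 0"
  "qRe 1 = 1" "qI 1 = 0" "qJ 1 = 0" "qK 1 = 0"
  "qRe (p + q) = qRe p + qRe q" "qI (p + q) = qI p + qI q"
  "qJ (p + q) = qJ p + qJ q" "qK (p + q) = qK p + qK q"
  "qRe (- p) = - qRe p" "qI (- p) = - qI p" "qJ (- p) = - qJ p" "qK (- p) = - qK p"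
  "qRe (p - q) = qRe p - qRe q" "qI (p - q) = qI p - qI q"
  "qJ (p - q) = qJ p - qJ q" "qK (p - q) = qK p - qK q"
  "qRe (p * q) = qRe p * qRe q - qI p * qI q - qJ p * qJ q - qK p * qK q"
  "qI (p * q) = qRe p * qI q + qI p * qRe q + qJ p * qK q - qK p * qJ q"
  "qJ (p * q) = qRe p * qJ q - qI p * qK q + qJ p * qRe q + qK p * qI q"
  "qK (p * q) = qRe p * qK q + qI p * qJ q - qJ p * qI q + qK p * qRe q"
  by (simp_all add: quat_arith_defs)

instantiation quat :: real_algebra_1
begin

definition "r *\<^sub>R q = Quat (r * qRe q) (r * qI q) (r * qJ q) (r * qK q)"

instance
  by standard (simp_all add: quat_eq_iff scaleR_quat_def algebra_simps)

end

lemma quat_scaleR_sel [simp]: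
  "qRe (r *\<^sub>R q) = r * qRe q" "qI (r *\<^sub>R q) = r * qI q"
  "qJ (r *\<^sub>R q) = r * qJ q" "qK (r *\<^sub>R q) = r * qK q"
  by (simp_all add: scaleR_quat_def)

lemma quat_of_real_sel [simp]:
  "qRe (of_real r) = r" "qI (of_real r) = 0" "qJ (of_real r) = 0" "qK (of_real r) = 0"
  by (simp_all add: of_real_def)

definition qcnj :: "quat \<Rightarrow> quat"
  where "qcnj q = Quat (qRe q) (- qI q) (- qJ q) (- qK q)"

lemma qcnj_sel [simp]:
  "qRe (qcnj q) = qRe q" "qI (qcnj q) = - qI q" "qJ (qcnj q) = - qJ q" "qK (qcnj q) = - qK q"
  by (simp_all add: qcnj_def)

instantiation quat :: real_inner
begin

definition "inner p q = qRe p * qRe q + qI p * qI q + qJ p * qJ q + qK p * qK q"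
definition "norm (q::quat) = sqrt (inner q q)"
definition "sgn q = inverse (norm q) *\<^sub>R (q::quat)"
definition "dist p q = norm (p - q :: quat)"
definition [code del]:
  "(uniformity :: (quat \<times> quat) filter) = (INF e\<in>{0 <..}. principal {(x, y). dist x y < e})"
definition [code del]:
  "open (U :: quat set) \<longleftrightarrow> (\<forall>x\<in>U. eventually (\<lambda>(x', y). x' = x \<longrightarrow> y \<in> U) uniformity)"

instance
proof
  fix p q r :: quat and c :: real
  show "inner p q = inner q p" "inner (p + q) r = inner p r + inner q r"
    "inner (c *\<^sub>R p) q = c * inner p q" "0 \<le> inner p p"
    by (simp_all add: inner_quat_def algebra_simps)
  show "inner p p = 0 \<longleftrightarrow> p = 0"
    by (simp add: inner_quat_def quat_eq_iff add_nonneg_eq_0_iff)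
qed (simp_all add: norm_quat_def sgn_quat_def dist_quat_def uniformity_quat_def open_quat_def)

end

lemma inner_mult_quat: "inner (p * q) (p * q) = inner p p * inner (q::quat) q"
  unfolding inner_quat_def quat_sel_simps by algebra

lemma qcnj_mult_self: "qcnj q * q = inner q q *\<^sub>R 1"
  and mult_qcnj_self: "q * qcnj q = inner q q *\<^sub>R 1"
  by (simp_all add: quat_eq_iff inner_quat_def mult.commute)

instantiation quat :: real_normed_div_algebra
begin

definition "inverse q = inverse (inner q q) *\<^sub>R qcnj q"
definition "p div q = p * inverse (q::quat)"

instance
proof
  fix p q :: quat
  show "norm (p * q) = norm p * norm q"
    by (simp only: norm_quat_def inner_mult_quat real_sqrt_mult)
  show "p div q = p * inverse q"
    by (simp add: divide_quat_def)
  show "inverse (0::quat) = 0"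
    by (simp add: inverse_quat_def)
  assume "p \<noteq> 0"
  then have "inner p p \<noteq> 0"
    by simp
  then show "inverse p * p = 1" "p * inverse p = 1"
    by (simp_all add: inverse_quat_def qcnj_mult_self mult_qcnj_self)
qed

end

instantiation quat :: euclidean_space
begin

definition "Basis = {Quat 1 0 0 0, Quat 0 1 0 0, Quat 0 0 1 0, Quat 0 0 0 1}"

instance
proof
  show "(\<forall>u\<in>Basis. inner x u = 0) \<longleftrightarrow> x = 0" for x :: quat
    by (simp add: Basis_quat_def inner_quat_def quat_eq_iff [of x])
qed (auto simp: Basis_quat_def inner_quat_def)

end

definition imaginary_units :: "quat set"
  where "imaginary_units = {q. q ^ 2 = - 1}"

definition halfplane :: "quat \<Rightarrow> quat set"
  where "halfplane \<iota> = {of_real a + \<iota> * of_real b |a b. 0 \<le> b}"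

abbreviation borel_halfplane :: "quat \<Rightarrow> quat measure"
  where "borel_halfplane \<iota> \<equiv> restrict_space borel (halfplane \<iota>)"


section \<open>Quaternionic Hilbert spaces and operators\<close>

text \<open>
  The underlying real Hilbert space structure (scalar multiplication by real quaternions, inner
  product the real part of the quaternionic one) is determined by the quaternionic
  structure. It is part of the class so that norm, topology and bounded operators are the
  library ones; in particular completeness is that of the sort \<^class>\<open>banach\<close> for the norm
  \<open>norm u = sqrt (qRe (qinner u u))\<close>.
\<close>

class quaternionic_hilbert = real_inner + banach +
  fixes scaleQ :: "'a \<Rightarrow> quat \<Rightarrow> 'a"  (infixl "*\<^sub>Q" 75)
    and qinner :: "'a \<Rightarrow> 'a \<Rightarrow> quat"
  assumes scaleQ_add_left: "(u + v) *\<^sub>Q q = u *\<^sub>Q q + v *\<^sub>Q q"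
    and scaleQ_add_right: "u *\<^sub>Q (p + q) = u *\<^sub>Q p + u *\<^sub>Q q"
    and scaleQ_scaleQ: "u *\<^sub>Q p *\<^sub>Q q = u *\<^sub>Q (p * q)"
    and scaleQ_one: "u *\<^sub>Q 1 = u"
    and scaleQ_of_real: "u *\<^sub>Q of_real r = r *\<^sub>R u"
    and qinner_right: "qinner u (v *\<^sub>Q p + w *\<^sub>Q q) = qinner u v * p + qinner u w * q"
    and qinner_cnj: "qinner u v = qcnj (qinner v u)"
    and qRe_qinner: "qRe (qinner u v) = inner u v"
    and nonzero: "\<exists>u. u \<noteq> 0"

lemma qinner_self: "qinner u u = of_real ((norm u)\<^sup>2)"
  for u :: "'h::quaternionic_hilbert"
proof -
  have "qinner u u = qcnj (qinner u u)"
    by (rule qinner_cnj)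
  then show ?thesis
    by (simp add: quat_eq_iff qRe_qinner power2_norm_eq_inner)
qed

instantiation quat :: quaternionic_hilbert
begin

definition "scaleQ p q = (p * q :: quat)"
definition "qinner p q = qcnj p * (q :: quat)"

instance
proof
  show "\<exists>u::quat. u \<noteq> 0"
    by (rule exI[of _ 1]) simp
qed (simp_all add: scaleQ_quat_def qinner_quat_def quat_eq_iff inner_quat_def algebra_simps)

end

text \<open>
  Elements of \<open>'h \<Rightarrow>\<^sub>L 'h\<close> are real-linear and bounded, so right quaternionic linearity only needs
  homogeneity.
\<close>

definition qops :: "('h::quaternionic_hilbert \<Rightarrow>\<^sub>L 'h) set"
  where "qops = {T. \<forall>u q. blinfun_apply T (u *\<^sub>Q q) = blinfun_apply T u *\<^sub>Q q}"

definition qadjoint :: "('h::quaternionic_hilbert \<Rightarrow>\<^sub>L 'h) \<Rightarrow> ('h \<Rightarrow>\<^sub>L 'h)"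
  where "qadjoint T =
    (THE S. S \<in> qops \<and> (\<forall>u v. qinner (blinfun_apply S u) v = qinner u (blinfun_apply T v)))"

definition qnormal :: "('h::quaternionic_hilbert \<Rightarrow>\<^sub>L 'h) \<Rightarrow> bool"
  where "qnormal T \<longleftrightarrow> T o\<^sub>L qadjoint T = qadjoint T o\<^sub>L T"

definition qpositive :: "('h::quaternionic_hilbert \<Rightarrow>\<^sub>L 'h) \<Rightarrow> bool"
  where "qpositive T \<longleftrightarrow> (\<forall>u. \<exists>r\<ge>0. qinner u (blinfun_apply T u) = of_real r)"

text \<open>The real span of all right multiples of \<open>N\<close> is the right quaternionic span of \<open>N\<close>.\<close>

definition hilbert_basis :: "'h::quaternionic_hilbert set \<Rightarrow> bool"
  where "hilbert_basis N \<longleftrightarrow>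
    (\<forall>z\<in>N. \<forall>w\<in>N. qinner z w = (if z = w then 1 else 0)) \<and>
    closure (span {z *\<^sub>Q q |z q. z \<in> N}) = UNIV"

definition left_mult :: "(quat \<Rightarrow> ('h::quaternionic_hilbert \<Rightarrow>\<^sub>L 'h)) \<Rightarrow> bool"
  where "left_mult L \<longleftrightarrow> range L \<subseteq> qops \<and>
    (\<exists>N. hilbert_basis N \<and>
      (\<forall>q u. ((\<lambda>z. z *\<^sub>Q q *\<^sub>Q qinner z u) has_sum blinfun_apply (L q) u) N))"


section \<open>Projection-valued measures and their integral\<close>

text \<open>
  Values of \<open>P\<close> outside the Borel sets of the half-plane are irrelevant. Finite families of disjoint
  sets are covered by the sequences that are eventually empty.
\<close>

definition qpvm :: "quat \<Rightarrow> (quat set \<Rightarrow> ('h::quaternionic_hilbert \<Rightarrow>\<^sub>L 'h)) \<Rightarrow> bool"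
  where "qpvm \<iota> P \<longleftrightarrow>
    (\<forall>E\<in>sets (borel_halfplane \<iota>). P E \<in> qops \<and> qpositive (P E)) \<and>
    P (halfplane \<iota>) = id_blinfun \<and>
    (\<forall>E\<in>sets (borel_halfplane \<iota>). \<forall>E'\<in>sets (borel_halfplane \<iota>). P E o\<^sub>L P E' = P (E \<inter> E')) \<and>
    (\<forall>E::nat \<Rightarrow> quat set. range E \<subseteq> sets (borel_halfplane \<iota>) \<longrightarrow> disjoint_family E \<longrightarrow>
      (\<forall>u. (\<lambda>n. blinfun_apply (P (E n)) u) sums blinfun_apply (P (\<Union>n. E n)) u))"

definition qsupp :: "quat \<Rightarrow> (quat set \<Rightarrow> ('h::quaternionic_hilbert \<Rightarrow>\<^sub>L 'h)) \<Rightarrow> quat set"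
  where "qsupp \<iota> P = halfplane \<iota> - \<Union>{U. openin (top_of_set (halfplane \<iota>)) U \<and> P U = 0}"

definition iqpvm ::
    "quat \<Rightarrow> (quat set \<Rightarrow> ('h::quaternionic_hilbert \<Rightarrow>\<^sub>L 'h)) \<Rightarrow> (quat \<Rightarrow> ('h \<Rightarrow>\<^sub>L 'h)) \<Rightarrow> bool"
  where "iqpvm \<iota> P L \<longleftrightarrow> qpvm \<iota> P \<and> left_mult L \<and>
    (\<forall>E\<in>sets (borel_halfplane \<iota>). \<forall>q. P E o\<^sub>L L q = L q o\<^sub>L P E)"

text \<open>
  The simple function is decomposed into its level sets, as for \<^const>\<open>simple_integral\<close>; by additivity
  of \<open>P\<close>, any other decomposition into disjoint Borel sets gives the same operator.
\<close>

definition iq_simple_integral ::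
    "quat \<Rightarrow> (quat set \<Rightarrow> ('h::quaternionic_hilbert \<Rightarrow>\<^sub>L 'h)) \<Rightarrow> (quat \<Rightarrow> ('h \<Rightarrow>\<^sub>L 'h))
      \<Rightarrow> (quat \<Rightarrow> quat) \<Rightarrow> ('h \<Rightarrow>\<^sub>L 'h)"
  where "iq_simple_integral \<iota> P L s =
    (\<Sum>y\<in>s ` halfplane \<iota>. L y o\<^sub>L P (s -` {y} \<inter> halfplane \<iota>))"

definition iq_has_integral ::
    "quat \<Rightarrow> (quat set \<Rightarrow> ('h::quaternionic_hilbert \<Rightarrow>\<^sub>L 'h)) \<Rightarrow> (quat \<Rightarrow> ('h \<Rightarrow>\<^sub>L 'h))
      \<Rightarrow> (quat \<Rightarrow> quat) \<Rightarrow> ('h \<Rightarrow>\<^sub>L 'h) \<Rightarrow> bool"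
  where "iq_has_integral \<iota> P L \<phi> A \<longleftrightarrow>
    (\<exists>s. (\<forall>n. simple_function (borel_halfplane \<iota>) (s n)) \<and>
      uniform_limit (halfplane \<iota>) s \<phi> sequentially \<and>
      (\<lambda>n. iq_simple_integral \<iota> P L (s n)) \<longlonglongrightarrow> A)"

text \<open>
  The integral of a function that is bounded and Borel on the support of \<open>P\<close>: its values elsewhere
  are replaced by \<open>0\<close>.
\<close>

definition iq_integral ::
    "quat \<Rightarrow> (quat set \<Rightarrow> ('h::quaternionic_hilbert \<Rightarrow>\<^sub>L 'h)) \<Rightarrow> (quat \<Rightarrow> ('h \<Rightarrow>\<^sub>L 'h))
      \<Rightarrow> (quat \<Rightarrow> quat) \<Rightarrow> ('h \<Rightarrow>\<^sub>L 'h)"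
  where "iq_integral \<iota> P L \<phi> =
    (THE A. iq_has_integral \<iota> P L (\<lambda>x. if x \<in> qsupp \<iota> P then \<phi> x else 0) A)"


section \<open>$L^2$ spaces, Hilbert sums and isometries\<close>

text \<open>
  The model space depends on measures and so is not a type: its structure is carried by a record.
\<close>

record 'a qspace =
  qcarrier :: "'a set"
  qadd :: "'a \<Rightarrow> 'a \<Rightarrow> 'a"
  qscale :: "'a \<Rightarrow> quat \<Rightarrow> 'a"
  qprod :: "'a \<Rightarrow> 'a \<Rightarrow> quat"

definition qnorm :: "'a qspace \<Rightarrow> 'a \<Rightarrow> real"
  where "qnorm S x = sqrt (qRe (qprod S x x))"

definition type_qspace :: "'h::quaternionic_hilbert qspace"
  where "type_qspace = \<lparr>qcarrier = UNIV, qadd = (+), qscale = scaleQ, qprod = qinner\<rparr>"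

lemma qnorm_type_qspace: "qnorm type_qspace u = norm u"
  by (simp add: qnorm_def type_qspace_def qRe_qinner norm_eq_sqrt_inner)

definition qisometry :: "'a qspace \<Rightarrow> 'b qspace \<Rightarrow> ('a \<Rightarrow> 'b) \<Rightarrow> bool"
  where "qisometry S S' V \<longleftrightarrow> bij_betw V (qcarrier S) (qcarrier S') \<and>
    (\<forall>x\<in>qcarrier S. \<forall>y\<in>qcarrier S. V (qadd S x y) = qadd S' (V x) (V y)) \<and>
    (\<forall>x\<in>qcarrier S. \<forall>q. V (qscale S x q) = qscale S' (V x) q) \<and>
    (\<forall>x\<in>qcarrier S. qnorm S' (V x) = qnorm S x)"

text \<open>
  The elements of \<open>L2 \<nu>\<close> are classes modulo equality \<open>\<nu>\<close>-almost everywhere. As the quantifier in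
  \<open>AE x in \<nu>\<close> ranges over \<open>space \<nu>\<close>, the values of representatives outside \<open>space \<nu>\<close> are immaterial.
\<close>

definition L2_functions :: "quat measure \<Rightarrow> (quat \<Rightarrow> quat) set"
  where "L2_functions \<nu> =
    {f. f \<in> borel_measurable \<nu> \<and> integrable \<nu> (\<lambda>x. (norm (f x))\<^sup>2)}"

definition ae_class :: "quat measure \<Rightarrow> (quat \<Rightarrow> quat) \<Rightarrow> (quat \<Rightarrow> quat) set"
  where "ae_class \<nu> f = {g. g \<in> borel_measurable \<nu> \<and> (AE x in \<nu>. f x = g x)}"

definition L2 :: "quat measure \<Rightarrow> (quat \<Rightarrow> quat) set qspace"
  where "L2 \<nu> =
    \<lparr>qcarrier = ae_class \<nu> ` L2_functions \<nu>,
     qadd = (\<lambda>F G. \<Union>f\<in>F. \<Union>g\<in>G. ae_class \<nu> (\<lambda>x. f x + g x)),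
     qscale = (\<lambda>F q. \<Union>f\<in>F. ae_class \<nu> (\<lambda>x. f x * q)),
     qprod = (\<lambda>F G. integral\<^sup>L \<nu> (\<lambda>x. qcnj ((SOME f. f \<in> F) x) * (SOME g. g \<in> G) x))\<rparr>"

definition hilbert_sum :: "'i set \<Rightarrow> ('i \<Rightarrow> 'a qspace) \<Rightarrow> ('i \<Rightarrow> 'a) qspace"
  where "hilbert_sum A S =
    \<lparr>qcarrier = {x \<in> (\<Pi>\<^sub>E i\<in>A. qcarrier (S i)). (\<lambda>i. (qnorm (S i) (x i))\<^sup>2) summable_on A},
     qadd = (\<lambda>x y. \<lambda>i\<in>A. qadd (S i) (x i) (y i)),
     qscale = (\<lambda>x q. \<lambda>i\<in>A. qscale (S i) (x i) q),
     qprod = (\<lambda>x y. \<Sum>\<^sub>\<infinity>i\<in>A. qprod (S i) (x i) (y i))\<rparr>"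

definition oplus :: "'i set \<Rightarrow> ('i \<Rightarrow> quat measure) \<Rightarrow> ('i \<Rightarrow> quat \<Rightarrow> quat) \<Rightarrow> 'i \<Rightarrow> (quat \<Rightarrow> quat) set"
  where "oplus A \<nu> f = (\<lambda>\<alpha>\<in>A. ae_class (\<nu> \<alpha>) (f \<alpha>))"

end

(*
  The vectors a with L_q a = a q form a real form of H. For such an a the numbers <a, P(E) a> define
  a finite measure nu_a, and the map sending a bounded Borel function phi to phi(T) a is isometric
  from L^2(nu_a) onto a dense part of the cyclic subspace of a, because the functional calculus is a
  *-homomorphism. Zorn's lemma gives a maximal family of such vectors with pairwise orthogonal cyclic
  subspaces; it is total, since averaging q w q^-1 over the quaternion units turns a vector orthogonal
  to all of them into a further member. A vector u then corresponds to the family of the densities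
  f_a determined by <phi(T) a, u> = integral of <phi, f_a> d nu_a.
*)

theory Submission
  imports Defs
begin

section \<open>Hilbert space and $L^2$ preliminaries\<close>

text \<open>The condition \<open>L q a = a *\<^sub>Q q\<close> is forced on the vector that V sends
  to the constant 1 in one summand: there q 1 = 1 q, while V must turn \<open>L q\<close> into left
  and right scalars into right pointwise multiplication. It is also what makes a scalar measure
  sufficient: \<open>L c (P E a)\<close> becomes \<open>P E a *\<^sub>Q c\<close>, and <a, P(E) a>
  is real, so a quaternionic coefficient passes through the inner product. Moreover a q = L_q a is
  the calculus of a constant applied to a, so the real subspace of all phi(T) a is already invariant
  under right scalars and under every L_q. Hence the argument runs with the real inner product, and
  quaternionic statements are recovered by letting the test functions absorb the scalars. Densities
  are in general unbounded, while the calculus takes bounded functions; the passage from densities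
  to vectors therefore goes through truncations. Linearity of V and its intertwining property are
  read off from pairings with test functions, not from a formula for V.\<close>

lemma parallelogram_identity:
  fixes a b :: "'a::real_inner"
  shows "(norm (a - b))\<^sup>2 = 2 * (norm a)\<^sup>2 + 2 * (norm b)\<^sup>2 - (norm (a + b))\<^sup>2"
  by (simp add: power2_norm_eq_inner inner_commute algebra_simps)

lemma Cauchy_if_norm_squared_le:
  fixes w :: "nat \<Rightarrow> 'a::real_normed_vector"
  assumes le: "\<And>m n. (norm (w m - w n))\<^sup>2 \<le> b m + b n" and b: "b \<longlonglongrightarrow> (0::real)"
  shows "Cauchy w"
proof (rule metric_CauchyI)
  fix e :: real assume "e > 0"
  then have "eventually (\<lambda>n. b n < e\<^sup>2 / 2) sequentially"
    using b by (intro order_tendstoD) auto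
  then obtain N where N: "\<And>n. n \<ge> N \<Longrightarrow> b n < e\<^sup>2 / 2"
    by (auto simp: eventually_sequentially)
  have "dist (w m) (w n) < e" if "m \<ge> N" "n \<ge> N" for m n
  proof -
    have "(norm (w m - w n))\<^sup>2 < e\<^sup>2"
      using le[of m n] N[OF that(1)] N[OF that(2)] by linarith
    then show ?thesis
      using \<open>e > 0\<close> by (auto simp: dist_norm intro: power2_less_imp_less)
  qed
  then show "\<exists>N. \<forall>m\<ge>N. \<forall>n\<ge>N. dist (w m) (w n) < e"
    by blast
qed

text \<open>The right-hand side is a quadratic polynomial in t that is smallest at 0; a nonzero
  linear coefficient would move its minimum elsewhere.\<close>

lemma orthogonal_if_nearest:
  fixes d x :: "'a::real_inner"
  assumes "\<And>t::real. (norm d)\<^sup>2 \<le> (norm (d - t *\<^sub>R x))\<^sup>2"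
  shows "inner x d = 0"
proof (cases "x = 0")
  case False
  \<comment> \<open>The minimiser of the quadratic.\<close>
  define t where "t = inner x d / inner x x"
  have "(norm d)\<^sup>2 \<le> (norm (d - t *\<^sub>R x))\<^sup>2"
    by (rule assms)
  then have "2 * t * inner x d \<le> t\<^sup>2 * inner x x"
    unfolding power2_norm_eq_inner by (simp add: inner_diff inner_commute power2_eq_square algebra_simps)
  then have "(inner x d)\<^sup>2 \<le> 0"
    using False by (simp add: t_def power2_eq_square field_simps)
  then show ?thesis by simp
qed simp

text \<open>\<open>S\<close> need not be closed, so v only lies in its closure, and the minimising
  sequence is returned with it. When \<open>S\<close> consists of the vectors
  \<open>\<Phi> \<phi> a\<close>, this sequence supplies the test functions whose L2 limit is the
  density of u.\<close>

lemma orthogonal_projection_sequence: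
  fixes S :: "'a::{real_inner, banach} set"
  assumes S: "subspace S"
  obtains w v where "\<And>n. w n \<in> S" "w \<longlonglongrightarrow> v" "\<And>x. x \<in> S \<Longrightarrow> inner x (u - v) = 0"
proof -
  define D where "D = (INF x\<in>S. (norm (u - x))\<^sup>2)"
  have bdd: "bdd_below ((\<lambda>x. (norm (u - x))\<^sup>2) ` S)"
    by (rule bdd_belowI[of _ 0]) auto
  have ne: "S \<noteq> {}" using S subspace_0 by auto
  have D_le: "D \<le> (norm (u - x))\<^sup>2" if "x \<in> S" for x
    unfolding D_def by (rule cINF_lower[OF bdd that])
  have "\<exists>x\<in>S. (norm (u - x))\<^sup>2 < D + inverse (real (Suc n))" for n
  proof (rule ccontr)
    assume "\<not> ?thesis"
    then have "D + inverse (real (Suc n)) \<le> D"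
      using ne unfolding D_def by (intro cINF_greatest) (auto simp: not_less)
    then show False by simp
  qed
  then obtain w where wS: "\<And>n. w n \<in> S"
    and w: "\<And>n. (norm (u - w n))\<^sup>2 < D + inverse (real (Suc n))"
    by metis
  have lim0: "(\<lambda>n. inverse (real (Suc n))) \<longlonglongrightarrow> 0"
    by (rule LIMSEQ_inverse_real_of_nat)
  have "(norm (w m - w n))\<^sup>2 \<le> 2 * inverse (real (Suc m)) + 2 * inverse (real (Suc n))" for m n
  proof -
    \<comment> \<open>The midpoint lies in \<open>S\<close>, so its squared distance to u is at
      least \<open>D\<close>; the parallelogram law then forces near-minimisers to be close to each
      other.\<close>
    define x where "x = (1/2) *\<^sub>R (w m + w n)"
    have "x \<in> S" using S wS by (simp add: x_def subspace_add subspace_scale)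
    then have "4 * D \<le> 4 * (norm (u - x))\<^sup>2" by (simp add: D_le)
    also have "\<dots> = (norm (2 *\<^sub>R (u - x)))\<^sup>2" by (simp add: power_mult_distrib)
    also have "2 *\<^sub>R (u - x) = (u - w m) + (u - w n)"
      by (simp add: x_def algebra_simps scaleR_2)
    finally have "4 * D \<le> (norm ((u - w m) + (u - w n)))\<^sup>2" .
    moreover have "(norm (w m - w n))\<^sup>2 = (norm ((u - w n) - (u - w m)))\<^sup>2"
      by simp
    ultimately show ?thesis
      using w[of m] w[of n] parallelogram_identity[of "u - w n" "u - w m"]
      by (simp add: add.commute)
  qed
  then have "Cauchy w"
    by (rule Cauchy_if_norm_squared_le) (use tendsto_mult_left[OF lim0, of 2] in simp)
  then obtain v where v: "w \<longlonglongrightarrow> v"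
    using Cauchy_convergent convergent_def by blast
  have "(norm (u - v))\<^sup>2 \<le> D"
  proof (rule LIMSEQ_le)
    show "(\<lambda>n. (norm (u - w n))\<^sup>2) \<longlonglongrightarrow> (norm (u - v))\<^sup>2"
      by (intro tendsto_intros v)
    show "(\<lambda>n. D + inverse (real (Suc n))) \<longlonglongrightarrow> D"
      using tendsto_add[OF tendsto_const lim0] by simp
  qed (use w less_imp_le in blast)
  moreover have "D \<le> (norm (u - v - t *\<^sub>R x))\<^sup>2" if "x \<in> S" for x t
  proof (rule LIMSEQ_le_const)
    show "(\<lambda>n. (norm (u - w n - t *\<^sub>R x))\<^sup>2) \<longlonglongrightarrow> (norm (u - v - t *\<^sub>R x))\<^sup>2"
      by (intro tendsto_intros v)
    have "D \<le> (norm (u - w n - t *\<^sub>R x))\<^sup>2" for n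
      using D_le[of "w n + t *\<^sub>R x"] S wS that
      by (simp add: subspace_add subspace_scale diff_diff_eq)
    then show "\<exists>N. \<forall>n\<ge>N. D \<le> (norm (u - w n - t *\<^sub>R x))\<^sup>2" by blast
  qed
  ultimately have "inner x (u - v) = 0" if "x \<in> S" for x
    using that by (intro orthogonal_if_nearest) (use order_trans in blast)
  with wS v show thesis by (rule that)
qed

text \<open>By Pythagoras the squared distance between nested partial sums is a partial sum of the
  squared norms, so the net of finite partial sums is Cauchy. The index set may be uncountable,
  hence filters in place of sequences.\<close>

lemma orthogonal_summable_on:
  fixes v :: "'i \<Rightarrow> 'a::{real_inner, banach}"
  assumes orth: "pairwise (\<lambda>i j. orthogonal (v i) (v j)) A"
    and sum: "(\<lambda>i. (norm (v i))\<^sup>2) summable_on A"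
  obtains u where "(v has_sum u) A" "((\<lambda>i. (norm (v i))\<^sup>2) has_sum (norm u)\<^sup>2) A"
proof -
  define F where "F = finite_subsets_at_top A"
  obtain l where l: "(sum (\<lambda>i. (norm (v i))\<^sup>2) \<longlongrightarrow> l) F"
    using sum by (auto simp: F_def summable_on_def has_sum_def)
  have pyth: "(norm (sum v X))\<^sup>2 = (\<Sum>i\<in>X. (norm (v i))\<^sup>2)" if "finite X" "X \<subseteq> A" for X
    using that orth by (intro norm_sum_Pythagorean) (auto intro: pairwise_subset)
  have "\<exists>P. eventually P F \<and> (\<forall>X Y. P X \<and> P Y \<longrightarrow> dist (sum v X) (sum v Y) < e)"
    if "e > 0" for e
  proof -
    \<comment> \<open>Twice e^2 / 16, once for \<open>X\<close> and once for \<open>Z\<close>, stays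
      below (e / 2)^2; two distances below e / 2 to the common \<open>Z\<close> then make e.\<close>
    have "eventually (\<lambda>X. dist (\<Sum>i\<in>X. (norm (v i))\<^sup>2) l < e\<^sup>2 / 16) F"
      using l \<open>e > 0\<close> by (intro tendstoD) auto
    then obtain Z where Z: "finite Z" "Z \<subseteq> A"
      and Zl: "\<And>X. finite X \<Longrightarrow> Z \<subseteq> X \<Longrightarrow> X \<subseteq> A \<Longrightarrow> dist (\<Sum>i\<in>X. (norm (v i))\<^sup>2) l < e\<^sup>2 / 16"
      by (auto simp: F_def eventually_finite_subsets_at_top)
    define P where "P X \<longleftrightarrow> finite X \<and> Z \<subseteq> X \<and> X \<subseteq> A" for X
    have near: "dist (sum v X) (sum v Z) < e / 2" if "P X" for X
    proof -
      from that have X: "finite X" "Z \<subseteq> X" "X \<subseteq> A" by (auto simp: P_def)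
      then have "(dist (sum v X) (sum v Z))\<^sup>2 = (norm (sum v (X - Z)))\<^sup>2"
        by (simp add: dist_norm sum_diff Z)
      also have "\<dots> = (\<Sum>i\<in>X - Z. (norm (v i))\<^sup>2)"
        using X by (intro pyth) auto
      also have "\<dots> = (\<Sum>i\<in>X. (norm (v i))\<^sup>2) - (\<Sum>i\<in>Z. (norm (v i))\<^sup>2)"
        using X Z by (simp add: sum_diff)
      also have "\<dots> < e\<^sup>2 / 16 + e\<^sup>2 / 16"
        using Zl[OF X] Zl[OF Z(1) order_refl Z(2)] unfolding dist_real_def by linarith
      also have "\<dots> \<le> (e / 2)\<^sup>2" by (simp add: power2_eq_square)
      finally show ?thesis
        by (rule power2_less_imp_less) (use \<open>e > 0\<close> in auto)
    qed
    have "eventually P F"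
      unfolding F_def eventually_finite_subsets_at_top P_def using Z by blast
    moreover have "dist (sum v X) (sum v Y) < e" if "P X" "P Y" for X Y
      using near[OF that(1)] near[OF that(2)] dist_triangle_half_l by blast
    ultimately show ?thesis by blast
  qed
  then have "cauchy_filter (filtermap (sum v) F)"
    by (simp add: cauchy_filter_metric_filtermap)
  moreover have "complete (UNIV :: 'a set)"
    by (meson Cauchy_convergent UNIV_I complete_def convergent_def)
  ultimately obtain u where u: "(sum v \<longlongrightarrow> u) F"
    using complete_uniform[where S = "UNIV :: 'a set"] by (force simp: filterlim_def F_def)
  have "((\<lambda>X. (norm (sum v X))\<^sup>2) \<longlongrightarrow> (norm u)\<^sup>2) F"
    by (intro tendsto_intros u)
  moreover have "eventually (\<lambda>X. (norm (sum v X))\<^sup>2 = (\<Sum>i\<in>X. (norm (v i))\<^sup>2)) F"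
    unfolding F_def by (rule eventually_finite_subsets_at_top_weakI) (rule pyth)
  ultimately have "(sum (\<lambda>i. (norm (v i))\<^sup>2) \<longlongrightarrow> (norm u)\<^sup>2) F"
    by (rule Lim_transform_eventually)
  with u show thesis
    by (intro that) (auto simp: has_sum_def F_def)
qed

section \<open>Completeness of L2 over a finite measure\<close>

lemma norm_add_squared_le: "(norm (a + b))\<^sup>2 \<le> 2 * (norm a)\<^sup>2 + 2 * (norm b :: real)\<^sup>2"
proof -
  have "(norm (a + b))\<^sup>2 \<le> (norm a + norm b)\<^sup>2"
    by (intro power_mono norm_triangle_ineq) auto
  also have "\<dots> \<le> 2 * (norm a)\<^sup>2 + 2 * (norm b)\<^sup>2"
    using zero_le_power2[of "norm a - norm b"] by (simp add: power2_eq_square algebra_simps)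
  finally show ?thesis .
qed

lemma norm_diff_squared_le: "(norm (a - b))\<^sup>2 \<le> 2 * (norm a)\<^sup>2 + 2 * (norm b :: real)\<^sup>2"
  using norm_add_squared_le[of a "- b"] by simp

lemma integrable_norm_squared_add:
  fixes f g :: "'a \<Rightarrow> 'b::{banach, second_countable_topology}"
  assumes [measurable]: "f \<in> borel_measurable M" "g \<in> borel_measurable M"
    and "integrable M (\<lambda>x. (norm (f x))\<^sup>2)" "integrable M (\<lambda>x. (norm (g x))\<^sup>2)"
  shows "integrable M (\<lambda>x. (norm (f x + g x))\<^sup>2)"
  by (rule Bochner_Integration.integrable_bound[of _ "\<lambda>x. 2 * (norm (f x))\<^sup>2 + 2 * (norm (g x))\<^sup>2"])
    (use assms norm_add_squared_le in auto)

lemma integrable_norm_squared_diff: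
  fixes f g :: "'a \<Rightarrow> 'b::{banach, second_countable_topology}"
  assumes "f \<in> borel_measurable M" "g \<in> borel_measurable M"
    and "integrable M (\<lambda>x. (norm (f x))\<^sup>2)" "integrable M (\<lambda>x. (norm (g x))\<^sup>2)"
  shows "integrable M (\<lambda>x. (norm (f x - g x))\<^sup>2)"
  using integrable_norm_squared_add[of f M "\<lambda>x. - g x"] assms by simp

text \<open>On a finite measure space the squared L2 bounds 4^-n give L1 bounds of order 2^-n for
  the increments. These are summable, so the telescoping series converges absolutely almost
  everywhere.\<close>

lemma (in finite_measure) Riesz_Fischer_subsequence:
  fixes s :: "nat \<Rightarrow> 'a \<Rightarrow> 'b::{banach, second_countable_topology}"
  assumes [measurable]: "\<And>n. s n \<in> borel_measurable M"
    and int: "\<And>m n. integrable M (\<lambda>x. (norm (s m x - s n x))\<^sup>2)"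
    and small: "\<And>n. (\<integral>x. (norm (s (Suc n) x - s n x))\<^sup>2 \<partial>M) \<le> (1/4) ^ n"
  shows "AE x in M. convergent (\<lambda>n. s n x)"
proof -
  define d where "d n x = norm (s (Suc n) x - s n x)" for n x
  have [measurable]: "d n \<in> borel_measurable M" for n
    unfolding d_def by measurable
  \<comment> \<open>The constant left after integrating \<open>h\<close> below: the first summand
    contributes the total mass, the second 2^n 4^-n = 2^-n.\<close>
  define c where "c = (measure M (space M) + 1) / 2"
  have c: "c \<ge> 0" by (simp add: c_def)
  have bound: "(\<integral>\<^sup>+x. ennreal (d n x) \<partial>M) \<le> ennreal (c * (1/2) ^ n)" for n
  proof -
    \<comment> \<open>The inequality between arithmetic and geometric means for 2^-n and 2^n d^2,
      written with the factor 2^n on the square: the weight balances both terms at size 2^-n after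
      integration.\<close>
    define h where "h x = ((1/2) ^ n + 2 ^ n * (d n x)\<^sup>2) / 2" for x
    have "d n x \<le> h x" for x
    proof -
      have "0 \<le> 2 ^ n * (d n x - (1/2) ^ n)\<^sup>2" by simp
      also have "\<dots> = 2 ^ n * (d n x)\<^sup>2 - 2 * d n x * (2 ^ n * (1/2) ^ n) + (2 ^ n * (1/2) ^ n) * (1/2) ^ n"
        by (simp add: power2_eq_square algebra_simps)
      also have "(2::real) ^ n * (1/2) ^ n = 1"
        by (simp add: power_mult_distrib[symmetric])
      finally show ?thesis by (simp add: h_def)
    qed
    then have "(\<integral>\<^sup>+x. ennreal (d n x) \<partial>M) \<le> (\<integral>\<^sup>+x. ennreal (h x) \<partial>M)"
      by (intro nn_integral_mono ennreal_leI)
    also have "\<dots> = ennreal (\<integral>x. h x \<partial>M)"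
      using int[of "Suc n" n] by (intro nn_integral_eq_integral) (auto simp: h_def d_def)
    also have "(\<integral>x. h x \<partial>M) = (measure M (space M) * (1/2) ^ n + 2 ^ n * (\<integral>x. (d n x)\<^sup>2 \<partial>M)) / 2"
      using int[of "Suc n" n] by (simp add: h_def d_def)
    also have "\<dots> \<le> (measure M (space M) * (1/2) ^ n + 2 ^ n * (1/4) ^ n) / 2"
      using small[of n] by (simp add: d_def)
    also have "\<dots> = c * (1/2) ^ n"
      by (simp add: c_def field_simps power_mult_distrib[symmetric])
    finally show ?thesis by (simp add: ennreal_leI)
  qed
  have "(\<integral>\<^sup>+x. (\<Sum>n. ennreal (d n x)) \<partial>M) = (\<Sum>n. \<integral>\<^sup>+x. ennreal (d n x) \<partial>M)"
    by (rule nn_integral_suminf) measurable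
  also have "\<dots> \<le> (\<Sum>n. ennreal (c * (1/2) ^ n))"
    by (intro suminf_le bound) auto
  also have "\<dots> = ennreal (\<Sum>n. c * (1/2) ^ n)"
    using c by (intro suminf_ennreal2) (auto intro!: summable_mult summable_geometric)
  also have "\<dots> < \<infinity>" by simp
  finally have "AE x in M. (\<Sum>n. ennreal (d n x)) \<noteq> \<infinity>"
    by (intro nn_integral_PInf_AE) auto
  then show ?thesis
  proof eventually_elim
    case (elim x)
    then have "summable (\<lambda>n. d n x)"
      by (intro summable_suminf_not_top) (auto simp: d_def)
    then have "summable (\<lambda>n. s (Suc n) x - s n x)"
      unfolding d_def by (rule summable_norm_cancel)
    then have "convergent (\<lambda>n. s n x - s 0 x)"
      using sum_lessThan_telescope[of "\<lambda>n. s n x"] by (simp add: summable_iff_convergent)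
    then show ?case
      by (simp add: convergent_diff_const_right_iff)
  qed
qed

text \<open>The limit is taken pointwise along a fast subsequence; Fatou then controls its L2
  distance to every term of the full sequence.\<close>

lemma (in finite_measure) Riesz_Fischer:
  fixes s :: "nat \<Rightarrow> 'a \<Rightarrow> 'b::{banach, second_countable_topology}"
  assumes [measurable]: "\<And>n. s n \<in> borel_measurable M"
    and int: "\<And>n. integrable M (\<lambda>x. (norm (s n x))\<^sup>2)"
    and Cauchy: "\<And>e. e > 0 \<Longrightarrow> \<exists>N. \<forall>m\<ge>N. \<forall>n\<ge>N. (\<integral>x. (norm (s m x - s n x))\<^sup>2 \<partial>M) \<le> e"
  obtains f where "f \<in> borel_measurable M" "integrable M (\<lambda>x. (norm (f x))\<^sup>2)"
    "(\<lambda>n. \<integral>x. (norm (s n x - f x))\<^sup>2 \<partial>M) \<longlonglongrightarrow> 0"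
proof -
  have intd: "integrable M (\<lambda>x. (norm (s m x - s n x))\<^sup>2)" for m n
    by (intro integrable_norm_squared_diff int) measurable
  have "\<exists>N. \<forall>k. \<forall>m\<ge>N k. \<forall>n\<ge>N k. (\<integral>x. (norm (s m x - s n x))\<^sup>2 \<partial>M) \<le> (1/4) ^ k"
    by (intro choice allI Cauchy) simp
  then obtain N where N: "\<And>k m n. m \<ge> N k \<Longrightarrow> n \<ge> N k \<Longrightarrow>
      (\<integral>x. (norm (s m x - s n x))\<^sup>2 \<partial>M) \<le> (1/4) ^ k"
    by blast
  \<comment> \<open>The maximum over all \<open>N j\<close> with j at most k makes both
    \<open>r k\<close> and \<open>r (Suc k)\<close> admissible for the bound 4^-k; inserting k makes
    \<open>r k\<close> tend to infinity.\<close>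
  define r where "r k = Max (insert k (N ` {..k}))" for k
  have r_N: "r k \<ge> N j" if "j \<le> k" for j k
    unfolding r_def using that by (intro Max_ge) auto
  have r_ge: "r k \<ge> k" for k
    by (auto simp: r_def intro!: Max_ge)
  have conv: "AE x in M. convergent (\<lambda>k. s (r k) x)"
    by (rule Riesz_Fischer_subsequence) (auto intro!: intd N r_N)
  define f where "f x = lim (\<lambda>k. s (r k) x)" for x
  have [measurable]: "f \<in> borel_measurable M"
    unfolding f_def by measurable
  \<comment> \<open>Fatou's lemma along \<open>r\<close>; the lower integral bound avoids assuming
    integrability of the limit, which is only derived from it.\<close>
  have close: "(\<integral>\<^sup>+x. ennreal ((norm (s n x - f x))\<^sup>2) \<partial>M) \<le> ennreal e"
    if "e > 0" and K: "\<And>m. m \<ge> K \<Longrightarrow> (\<integral>x. (norm (s n x - s m x))\<^sup>2 \<partial>M) \<le> e" for n e K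
  proof -
    have "(\<integral>\<^sup>+x. ennreal ((norm (s n x - f x))\<^sup>2) \<partial>M)
        = (\<integral>\<^sup>+x. liminf (\<lambda>k. ennreal ((norm (s n x - s (r k) x))\<^sup>2)) \<partial>M)"
    proof (rule nn_integral_cong_AE, use conv in eventually_elim)
      case (elim x)
      then have "(\<lambda>k. s (r k) x) \<longlonglongrightarrow> f x"
        by (simp add: f_def convergent_LIMSEQ_iff)
      then have "(\<lambda>k. ennreal ((norm (s n x - s (r k) x))\<^sup>2)) \<longlonglongrightarrow> ennreal ((norm (s n x - f x))\<^sup>2)"
        by (intro tendsto_ennrealI tendsto_intros)
      then show ?case
        by (intro lim_imp_Liminf[symmetric]) auto
    qed
    also have "\<dots> \<le> liminf (\<lambda>k. \<integral>\<^sup>+x. ennreal ((norm (s n x - s (r k) x))\<^sup>2) \<partial>M)"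
      by (rule nn_integral_liminf) measurable
    also have "\<dots> \<le> liminf (\<lambda>k. ennreal e)"
    proof (rule Liminf_mono, rule eventually_sequentiallyI)
      fix k assume "k \<ge> K"
      then have "r k \<ge> K" using r_ge[of k] by simp
      then show "(\<integral>\<^sup>+x. ennreal ((norm (s n x - s (r k) x))\<^sup>2) \<partial>M) \<le> ennreal e"
        using K[of "r k"] by (subst nn_integral_eq_integral[OF intd]) (auto intro: ennreal_leI)
    qed
    finally show ?thesis by (simp add: Liminf_const)
  qed
  have fin: "integrable M (\<lambda>x. (norm (s n x - f x))\<^sup>2)"
    if "e > 0" and K: "\<And>m. m \<ge> K \<Longrightarrow> (\<integral>x. (norm (s n x - s m x))\<^sup>2 \<partial>M) \<le> e" for n e K
    using close[of e K n, OF that(1) K] by (intro integrableI_bounded) (auto intro: le_less_trans)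
  obtain K where K: "\<And>m n. m \<ge> K \<Longrightarrow> n \<ge> K \<Longrightarrow> (\<integral>x. (norm (s m x - s n x))\<^sup>2 \<partial>M) \<le> 1"
    using Cauchy[of 1] by auto
  \<comment> \<open>f is recovered as the difference of two square-integrable functions.\<close>
  have "integrable M (\<lambda>x. (norm (s K x - (s K x - f x)))\<^sup>2)"
    by (rule integrable_norm_squared_diff) (use int fin[of 1 K K] K in auto)
  then have intf: "integrable M (\<lambda>x. (norm (f x))\<^sup>2)" by simp
  have intsf: "integrable M (\<lambda>x. (norm (s n x - f x))\<^sup>2)" for n
    by (intro integrable_norm_squared_diff int intf) measurable
  have "(\<lambda>n. \<integral>x. (norm (s n x - f x))\<^sup>2 \<partial>M) \<longlonglongrightarrow> 0"
  proof (rule LIMSEQ_I)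
    fix e :: real assume "e > 0"
    then obtain K where K: "\<And>m n. m \<ge> K \<Longrightarrow> n \<ge> K \<Longrightarrow> (\<integral>x. (norm (s m x - s n x))\<^sup>2 \<partial>M) \<le> e / 2"
      using Cauchy[of "e / 2"] by auto
    have "(\<integral>x. (norm (s n x - f x))\<^sup>2 \<partial>M) \<le> e / 2" if "n \<ge> K" for n
    proof -
      have "(\<integral>\<^sup>+x. ennreal ((norm (s n x - f x))\<^sup>2) \<partial>M) \<le> ennreal (e / 2)"
        using \<open>e > 0\<close> K that by (intro close) auto
      then show ?thesis
        using \<open>e > 0\<close> by (simp add: nn_integral_eq_integral[OF intsf])
    qed
    then show "\<exists>K. \<forall>n\<ge>K. norm ((\<integral>x. (norm (s n x - f x))\<^sup>2 \<partial>M) - 0) < e"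
      using \<open>e > 0\<close> by (intro exI[of _ K]) (fastforce simp: abs_of_nonneg)
  qed
  with \<open>f \<in> borel_measurable M\<close> intf show thesis by (rule that)
qed

section \<open>Algebra of quaternionic scalars and inner products\<close>

lemma qinner_add_right: "qinner u (v + w) = qinner u v + qinner u w"
  using qinner_right[of u v 1 w 1] by (simp add: scaleQ_one)

lemma scaleQ_zero_right [simp]: "u *\<^sub>Q 0 = (0 :: 'a::quaternionic_hilbert)"
  using scaleQ_of_real[of u 0] by simp

lemma qinner_scaleQ_right: "qinner u (v *\<^sub>Q p) = qinner u v * p"
  using qinner_right[of u v p 0 0] by simp

lemma qcnj_mult: "qcnj (p * q) = qcnj q * qcnj p"
  by (simp add: quat_eq_iff algebra_simps)

lemma qcnj_qcnj [simp]: "qcnj (qcnj q) = q"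
  by (simp add: quat_eq_iff)

lemma qcnj_add: "qcnj (p + q) = qcnj p + qcnj q"
  by (simp add: quat_eq_iff)

lemma inner_quat_eq_qRe: "inner p q = qRe (qcnj p * q)"
  by (simp add: inner_quat_def)

lemma qRe_mult_commute: "qRe (p * q) = qRe (q * p)"
  by (simp add: algebra_simps)

lemma norm_qcnj [simp]: "norm (qcnj q) = norm q"
  by (simp add: norm_quat_def inner_quat_def)

lemma qinner_add_left: "qinner (u + v) w = qinner u w + qinner v w"
  using qinner_cnj[of "u + v" w] qinner_cnj[of u w] qinner_cnj[of v w]
  by (simp add: qinner_add_right qcnj_add)

lemma qinner_scaleQ_left: "qinner (u *\<^sub>Q p) v = qcnj p * qinner u v"
  using qinner_cnj[of "u *\<^sub>Q p" v] qinner_cnj[of u v]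
  by (simp add: qinner_scaleQ_right qcnj_mult)

lemma inner_scaleQ_left: "inner (u *\<^sub>Q q) v = inner u (v *\<^sub>Q qcnj q)"
  for u v :: "'a::quaternionic_hilbert"
  by (simp only: qRe_qinner[symmetric] qinner_scaleQ_left qinner_scaleQ_right qRe_mult_commute)

lemma scaleQ_scaleR_right: "u *\<^sub>Q (r *\<^sub>R q) = r *\<^sub>R (u *\<^sub>Q q)"
  for u :: "'a::quaternionic_hilbert"
proof -
  have "r *\<^sub>R q = q * of_real r" by (simp add: quat_eq_iff)
  then show ?thesis by (simp add: scaleQ_scaleQ[symmetric] scaleQ_of_real)
qed

lemma norm_scaleQ: "norm (u *\<^sub>Q q) = norm u * norm q"
  for u :: "'a::quaternionic_hilbert"
proof -
  have "(norm (u *\<^sub>Q q))\<^sup>2 = inner u (u *\<^sub>Q (q * qcnj q))"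
    by (simp add: power2_norm_eq_inner inner_scaleQ_left scaleQ_scaleQ)
  also have "\<dots> = (norm u * norm q)\<^sup>2"
    by (simp add: mult_qcnj_self scaleQ_scaleR_right scaleQ_one power2_norm_eq_inner power_mult_distrib)
  finally show ?thesis by simp
qed

lemma bounded_linear_scaleQ_left: "bounded_linear (\<lambda>u::'a::quaternionic_hilbert. u *\<^sub>Q q)"
proof (rule bounded_linear_intro)
  show "(r *\<^sub>R u) *\<^sub>Q q = r *\<^sub>R (u *\<^sub>Q q)" for r and u :: 'a
  proof -
    have "(r *\<^sub>R u) *\<^sub>Q q = u *\<^sub>Q (of_real r * q)"
      by (simp add: scaleQ_of_real[symmetric] scaleQ_scaleQ)
    also have "of_real r * q = r *\<^sub>R q" by (simp add: quat_eq_iff)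
    finally show ?thesis by (simp add: scaleQ_scaleR_right)
  qed
qed (auto simp: scaleQ_add_left norm_scaleQ)

lemma qops_scaleQ: "T \<in> qops \<Longrightarrow> blinfun_apply T (u *\<^sub>Q q) = blinfun_apply T u *\<^sub>Q q"
  by (simp add: qops_def)

text \<open>
  Reality of \<open>qinner u (T u)\<close> for all \<open>u\<close> gives symmetry by polarisation: the difference of the two
  sides is real for all \<open>u\<close> and \<open>v\<close>, hence also after multiplying \<open>v\<close> by a quaternion, hence zero.
\<close>

lemma qpositive_symmetric:
  fixes T :: "'h::quaternionic_hilbert \<Rightarrow>\<^sub>L 'h"
  assumes T: "T \<in> qops" "qpositive T"
  shows "qinner (blinfun_apply T u) v = qinner u (blinfun_apply T v)"
proof -
  define d where "d v = qinner u (blinfun_apply T v) - qinner (blinfun_apply T u) v" for v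
  have real: "qI (qinner w (blinfun_apply T w)) = 0" "qJ (qinner w (blinfun_apply T w)) = 0"
    "qK (qinner w (blinfun_apply T w)) = 0" for w
    using T(2) unfolding qpositive_def by (metis quat_of_real_sel)+
  have d_real: "qI (d v) = 0" "qJ (d v) = 0" "qK (d v) = 0" for v
    using real[of "u + v"] real[of u] real[of v] qinner_cnj[of "blinfun_apply T u" v]
    by (simp_all add: d_def blinfun.add_right qinner_add_left qinner_add_right)
  have d_mult: "d (v *\<^sub>Q q) = d v * q" for q
    by (simp add: d_def qops_scaleQ[OF T(1)] qinner_scaleQ_right left_diff_distrib)
  have "qRe (d v) = 0"
    using d_real(1)[of "v *\<^sub>Q Quat 0 1 0 0"] by (simp add: d_mult d_real)
  then have "d v = 0"
    using d_real[of v] by (simp add: quat_eq_iff)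
  then show ?thesis by (simp add: d_def)
qed

text \<open>Each coordinate is rounded down to a multiple of 1 / (n + 1). Boundedness leaves
  finitely many values, and the error is at most the dimension divided by n + 1.\<close>

lemma uniform_simple_approximation:
  fixes f :: "'a \<Rightarrow> 'b::euclidean_space"
  assumes [measurable]: "f \<in> borel_measurable M" and bdd: "bounded (f ` space M)"
  obtains s where "\<And>n. simple_function M (s n)" "uniform_limit (space M) s f sequentially"
proof -
  define c where "c n x b = real_of_int \<lfloor>real (Suc n) * inner (f x) b\<rfloor> / real (Suc n)" for n x b
  define s where "s n x = (\<Sum>b\<in>Basis. c n x b *\<^sub>R b)" for n x
  obtain K where K: "\<And>x. x \<in> space M \<Longrightarrow> norm (f x) \<le> K"
    using bdd by (auto simp: bounded_iff)
  have "simple_function M (\<lambda>x. c n x b)" if "b \<in> Basis" for n b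
  proof (rule simple_function_borel_measurable)
    show "(\<lambda>x. c n x b) \<in> borel_measurable M"
      unfolding c_def by measurable
    have "(\<lambda>x. c n x b) ` space M \<subseteq>
        (\<lambda>i. real_of_int i / real (Suc n)) ` {\<lfloor>- (real (Suc n) * K)\<rfloor>..\<lfloor>real (Suc n) * K\<rfloor>}"
    proof
      fix y assume "y \<in> (\<lambda>x. c n x b) ` space M"
      then obtain x where x: "x \<in> space M" "y = c n x b" by auto
      have "\<bar>inner (f x) b\<bar> \<le> K"
        using Basis_le_norm[OF that] K[OF x(1)] order_trans by blast
      then have "- K \<le> inner (f x) b" "inner (f x) b \<le> K" by linarith+
      then have "real (Suc n) * - K \<le> real (Suc n) * inner (f x) b"
        "real (Suc n) * inner (f x) b \<le> real (Suc n) * K"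
        by (intro mult_left_mono; simp)+
      then have "\<lfloor>real (Suc n) * inner (f x) b\<rfloor> \<in>
          {\<lfloor>- (real (Suc n) * K)\<rfloor>..\<lfloor>real (Suc n) * K\<rfloor>}"
        by (auto intro!: floor_mono)
      then show "y \<in> (\<lambda>i. real_of_int i / real (Suc n)) `
          {\<lfloor>- (real (Suc n) * K)\<rfloor>..\<lfloor>real (Suc n) * K\<rfloor>}"
        unfolding x c_def by (rule imageI)
    qed
    then show "finite ((\<lambda>x. c n x b) ` space M)"
      by (rule finite_subset) auto
  qed
  then have simple: "simple_function M (s n)" for n
    unfolding s_def by (intro simple_function_sum simple_function_compose1[where g = "\<lambda>r. r *\<^sub>R _"])
  have bound: "norm (s n x - f x) \<le> real DIM('b) * inverse (real (Suc n))" for n x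
  proof -
    have "s n x - f x = (\<Sum>b\<in>Basis. (c n x b - inner (f x) b) *\<^sub>R b)"
      by (simp add: s_def scaleR_diff_left sum_subtractf euclidean_representation)
    also have "norm \<dots> \<le> (\<Sum>b\<in>(Basis::'b set). inverse (real (Suc n)))"
    proof (rule sum_norm_le)
      fix b :: 'b assume "b \<in> Basis"
      have "\<bar>real_of_int \<lfloor>real (Suc n) * inner (f x) b\<rfloor> - real (Suc n) * inner (f x) b\<bar> \<le> 1"
        by linarith
      moreover have "c n x b - inner (f x) b =
          (real_of_int \<lfloor>real (Suc n) * inner (f x) b\<rfloor> - real (Suc n) * inner (f x) b) / real (Suc n)"
        by (simp add: c_def diff_divide_distrib del: of_nat_Suc)
      ultimately have "\<bar>c n x b - inner (f x) b\<bar> \<le> inverse (real (Suc n))"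
        by (simp add: abs_divide inverse_eq_divide divide_right_mono del: of_nat_Suc)
      then show "norm ((c n x b - inner (f x) b) *\<^sub>R b) \<le> inverse (real (Suc n))"
        using \<open>b \<in> Basis\<close> by simp
    qed
    finally show ?thesis by simp
  qed
  have "uniform_limit (space M) s f sequentially"
  proof (rule uniform_limitI)
    fix e :: real assume "e > 0"
    have "(\<lambda>n. real DIM('b) * inverse (real (Suc n))) \<longlonglongrightarrow> real DIM('b) * 0"
      by (intro tendsto_mult_left LIMSEQ_inverse_real_of_nat)
    then have "eventually (\<lambda>n. real DIM('b) * inverse (real (Suc n)) < e) sequentially"
      using \<open>e > 0\<close> by (intro order_tendstoD) auto
    then show "\<forall>\<^sub>F n in sequentially. \<forall>x\<in>space M. dist (s n x) (f x) < e"
      by eventually_elim (use bound in \<open>auto simp: dist_norm intro: le_less_trans\<close>)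
  qed
  with simple show thesis by (rule that)
qed

section \<open>The functional calculus of an intertwining projection-valued measure\<close>

locale left_multiplication =
  fixes L :: "quat \<Rightarrow> ('h::quaternionic_hilbert \<Rightarrow>\<^sub>L 'h)"
  assumes left_mult: "left_mult L"
begin

lemma L_scaleQ: "L p (u *\<^sub>Q q) = L p u *\<^sub>Q q"
  using left_mult by (auto simp: left_mult_def intro: qops_scaleQ)

text \<open>\<open>L\<close> does not determine its basis (z may be replaced by -z), so one is fixed
  by choice.\<close>

definition N where "N = (SOME N. hilbert_basis N \<and>
      (\<forall>q u. ((\<lambda>z. z *\<^sub>Q q *\<^sub>Q qinner z u) has_sum blinfun_apply (L q) u) N))"

lemma N: "hilbert_basis N" "((\<lambda>z. z *\<^sub>Q q *\<^sub>Q qinner z u) has_sum L q u) N"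
proof -
  have "hilbert_basis N \<and> (\<forall>q u. ((\<lambda>z. z *\<^sub>Q q *\<^sub>Q qinner z u) has_sum blinfun_apply (L q) u) N)"
    unfolding N_def by (rule someI_ex) (use left_mult in \<open>simp add: left_mult_def\<close>)
  then show "hilbert_basis N" "((\<lambda>z. z *\<^sub>Q q *\<^sub>Q qinner z u) has_sum L q u) N"
    by auto
qed

lemma L_basis: "z \<in> N \<Longrightarrow> L q z = z *\<^sub>Q q"
proof -
  assume z: "z \<in> N"
  have "((\<lambda>w. w *\<^sub>Q q *\<^sub>Q qinner w z) has_sum (z *\<^sub>Q q)) N \<longleftrightarrow>
      ((\<lambda>w. w *\<^sub>Q q *\<^sub>Q qinner w z) has_sum (z *\<^sub>Q q)) {z}"
    using N(1) z by (intro has_sum_cong_neutral) (auto simp: hilbert_basis_def)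
  also have "\<dots>"
    using N(1) z by (intro has_sum_finiteI) (auto simp: hilbert_basis_def scaleQ_one)
  finally show ?thesis
    using N(2) has_sum_unique by blast
qed

lemma L_add: "L (p + q) = L p + L q"
proof (rule blinfun_eqI)
  fix u
  have "((\<lambda>z. z *\<^sub>Q (p + q) *\<^sub>Q qinner z u) has_sum (L p u + L q u)) N"
    using has_sum_add[OF N(2)[of p u] N(2)[of q u]] by (simp add: scaleQ_add_right scaleQ_add_left)
  then show "L (p + q) u = (L p + L q) u"
    using N(2) by (auto simp: plus_blinfun.rep_eq intro: has_sum_unique)
qed

lemma L_scaleR: "L (r *\<^sub>R q) = r *\<^sub>R L q"
proof (rule blinfun_eqI)
  fix u
  have "((\<lambda>z. r *\<^sub>R (z *\<^sub>Q q *\<^sub>Q qinner z u)) has_sum (r *\<^sub>R L q u)) N"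
    using has_sum_bounded_linear[OF bounded_linear_scaleR_right N(2)] by (simp add: o_def)
  moreover have "z *\<^sub>Q (r *\<^sub>R q) *\<^sub>Q y = r *\<^sub>R (z *\<^sub>Q q *\<^sub>Q y)" for z :: 'h and y
    using linear_scale[OF bounded_linear.linear[OF bounded_linear_scaleQ_left]] by (simp add: scaleQ_scaleR_right)
  ultimately show "L (r *\<^sub>R q) u = (r *\<^sub>R L q) u"
    using N(2)[of "r *\<^sub>R q" u] by (auto simp: scaleR_blinfun.rep_eq intro: has_sum_unique)
qed

lemma L_zero: "L 0 = 0"
  using L_scaleR[of 0 0] by simp

lemma L_minus: "L (- q) = - L q"
  using L_scaleR[of "-1" q] by simp

text \<open>This is the Fourier expansion of u in \<open>N\<close>. The fixed vectors of
  \<open>L 1\<close> form a closed real subspace containing all z q, so the totality of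
  \<open>N\<close> gives the claim.\<close>

lemma L_one: "L 1 = id_blinfun"
proof (rule blinfun_eqI)
  fix u
  have "subspace {u. L 1 u = u}"
    by (auto simp: subspace_def blinfun.add_right blinfun.scaleR_right)
  moreover have "{z *\<^sub>Q q |z q. z \<in> N} \<subseteq> {u. L 1 u = u}"
    by (auto simp: L_scaleQ L_basis scaleQ_one)
  ultimately have "span {z *\<^sub>Q q |z q. z \<in> N} \<subseteq> {u. L 1 u = u}"
    by (rule span_minimal[rotated])
  moreover have "closed {u. L 1 u = u}"
    by (intro closed_Collect_eq continuous_intros)
  ultimately have "closure (span {z *\<^sub>Q q |z q. z \<in> N}) \<subseteq> {u. L 1 u = u}"
    by (rule closure_minimal)
  then show "L 1 u = id_blinfun u"
    using N(1) by (auto simp: hilbert_basis_def)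
qed

text \<open>\<open>L q\<close> inserts q between a basis vector z and its coefficient <z, u>, so a
  later \<open>L p\<close> inserts p directly after z, to the left of q.\<close>

lemma L_mult: "L p (L q u) = L (p * q) u"
proof -
  have "((\<lambda>z. L p (z *\<^sub>Q q *\<^sub>Q qinner z u)) has_sum L p (L q u)) N"
    using has_sum_bounded_linear[OF blinfun.bounded_linear_right N(2), of "L p"] by (simp add: o_def)
  moreover have "L p (z *\<^sub>Q q *\<^sub>Q qinner z u) = z *\<^sub>Q (p * q) *\<^sub>Q qinner z u" if "z \<in> N" for z
    by (simp add: L_scaleQ L_basis[OF that] scaleQ_scaleQ mult.assoc)
  ultimately have "((\<lambda>z. z *\<^sub>Q (p * q) *\<^sub>Q qinner z u) has_sum L p (L q u)) N"
    using has_sum_cong by force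
  then show ?thesis
    using N(2) has_sum_unique by blast
qed

text \<open>Both sides expand over \<open>N\<close>; corresponding terms are conjugate quaternions
  and so have the same real part.\<close>

lemma L_adjoint: "inner (L q u) v = inner u (L (qcnj q) v)"
proof -
  have sum: "((\<lambda>z. qRe (qinner w z * q * qinner z u)) has_sum inner w (L q u)) N" for q w u
    using has_sum_bounded_linear[OF bounded_linear_inner_right N(2), of w q u]
    by (simp add: o_def qRe_qinner[symmetric] qinner_scaleQ_right)
  have "qRe (qinner u z * qcnj q * qinner z v) = qRe (qinner v z * q * qinner z u)" for z
  proof -
    have "qRe (qinner u z * qcnj q * qinner z v) = qRe (qcnj (qinner u z * qcnj q * qinner z v))"
      by (simp only: qcnj_sel)
    then show ?thesis
      by (simp only: qcnj_mult qcnj_qcnj qinner_cnj[symmetric] mult.assoc)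
  qed
  then have "((\<lambda>z. qRe (qinner v z * q * qinner z u)) has_sum inner u (L (qcnj q) v)) N"
    using sum[of u "qcnj q" v] by simp
  with sum[of v q u] show ?thesis
    using has_sum_unique inner_commute by metis
qed

end

section \<open>The projection-valued measure and the integral of simple functions\<close>

locale intertwining_pvm =
  fixes \<iota> :: quat and P :: "quat set \<Rightarrow> ('h::quaternionic_hilbert \<Rightarrow>\<^sub>L 'h)" and L :: "quat \<Rightarrow> ('h \<Rightarrow>\<^sub>L 'h)"
  assumes iqpvm: "iqpvm \<iota> P L"
begin

sublocale left_multiplication L
  using iqpvm by unfold_locales (simp add: iqpvm_def)

abbreviation "X \<equiv> halfplane \<iota>"
abbreviation "BX \<equiv> borel_halfplane \<iota>"

lemma qpvm: "qpvm \<iota> P"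
  using iqpvm by (simp add: iqpvm_def)

lemma P_scaleQ: "E \<in> sets BX \<Longrightarrow> P E (u *\<^sub>Q q) = P E u *\<^sub>Q q"
  using qpvm by (intro qops_scaleQ) (auto simp: qpvm_def)

lemma P_symmetric: "E \<in> sets BX \<Longrightarrow> inner (P E u) v = inner u (P E v)"
  using qpvm qpositive_symmetric[of "P E" u v] by (auto simp: qpvm_def qRe_qinner[symmetric])

lemma P_positive: "E \<in> sets BX \<Longrightarrow> inner u (P E u) \<ge> 0"
  and qinner_P: "E \<in> sets BX \<Longrightarrow> qinner u (P E u) = of_real (inner u (P E u))"
proof -
  assume "E \<in> sets BX"
  then have "qpositive (P E)"
    using qpvm by (simp add: qpvm_def)
  then obtain r where r: "r \<ge> 0" "qinner u (P E u) = of_real r"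
    unfolding qpositive_def by metis
  then have "inner u (P E u) = r" by (simp add: qRe_qinner[symmetric])
  with r show "inner u (P E u) \<ge> 0" "qinner u (P E u) = of_real (inner u (P E u))" by auto
qed

lemma P_Int: "E \<in> sets BX \<Longrightarrow> F \<in> sets BX \<Longrightarrow> P E (P F u) = P (E \<inter> F) u"
  using qpvm blinfun_apply_blinfun_compose[of "P E" "P F" u] by (simp add: qpvm_def)

lemma P_L: "E \<in> sets BX \<Longrightarrow> P E (L q u) = L q (P E u)"
  using iqpvm blinfun_apply_blinfun_compose[of "P E" "L q" u]
    blinfun_apply_blinfun_compose[of "L q" "P E" u] by (simp add: iqpvm_def)

lemma P_space: "P X u = u"
  using qpvm by (simp add: qpvm_def)

lemma P_sums:
  fixes E :: "nat \<Rightarrow> quat set"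
  assumes "range E \<subseteq> sets BX" "disjoint_family E"
  shows "(\<lambda>n. P (E n) u) sums P (\<Union>n. E n) u"
  using qpvm assms by (auto simp: qpvm_def)

lemma P_empty: "P {} u = 0"
proof -
  have "(\<lambda>n::nat. P {} u) sums P {} u"
    using P_sums[of "\<lambda>_. {}" u] by (simp add: disjoint_family_on_def)
  then show ?thesis
    using sums_summable summable_const_iff by blast
qed

lemma P_Un:
  assumes "E \<in> sets BX" "F \<in> sets BX" "E \<inter> F = {}"
  shows "P (E \<union> F) u = P E u + P F u"
proof -
  have "range (binaryset E F) \<subseteq> sets BX"
    using assms by (simp add: range_binaryset_eq)
  moreover have "disjoint_family (binaryset E F)"
    using assms(3) by (auto simp: disjoint_family_on_def binaryset_def)
  ultimately have "(\<lambda>n. P (binaryset E F n) u) sums P (E \<union> F) u"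
    using P_sums[of "binaryset E F" u] by (simp add: UN_binaryset_eq)
  moreover have "(\<lambda>n. P (binaryset E F n) u) sums (P E u + P F u)"
    using P_empty by (intro binaryset_sums[where f = "\<lambda>E. P E u"])
  ultimately show ?thesis by (rule sums_unique2)
qed

lemma P_UN:
  assumes "finite J" "\<And>j. j \<in> J \<Longrightarrow> E j \<in> sets BX" "disjoint_family_on E J"
  shows "P (\<Union>j\<in>J. E j) u = (\<Sum>j\<in>J. P (E j) u)"
  using assms
proof (induction J rule: finite_induct)
  case empty
  then show ?case by (simp add: P_empty)
next
  case (insert j J)
  have "P (\<Union>i\<in>insert j J. E i) u = P (E j) u + P (\<Union>i\<in>J. E i) u"
    using insert.prems insert.hyps unfolding UN_insert
    by (intro P_Un sets.finite_UN) (auto simp: disjoint_family_on_def)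
  then show ?case
    using insert by (simp add: disjoint_family_on_def)
qed

abbreviation I :: "(quat \<Rightarrow> quat) \<Rightarrow> ('h \<Rightarrow>\<^sub>L 'h)"
  where "I s \<equiv> iq_simple_integral \<iota> P L s"

lemma fibre_sets: "simple_function BX h \<Longrightarrow> h -` {c} \<inter> X \<in> sets BX"
  using simple_functionD(2)[of BX h] by (simp add: space_restrict_space)

lemma image_finite: "simple_function BX h \<Longrightarrow> finite (h ` X)"
  using simple_functionD(1)[of BX h] by (simp add: space_restrict_space)

text \<open>
  Two simple functions \<open>s\<close>, \<open>t\<close> are brought to a common partition by taking \<open>h x = (s x, t x)\<close>.
\<close>

lemma I_partition:
  assumes h: "simple_function BX h"
  shows "I (\<lambda>x. g (h x)) u = (\<Sum>c\<in>h ` X. L (g c) (P (h -` {c} \<inter> X) u))"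
proof -
  have fin: "finite (h ` X)" using h by (rule image_finite)
  have "P ((\<lambda>x. g (h x)) -` {y} \<inter> X) u = (\<Sum>c\<in>{c \<in> h ` X. g c = y}. P (h -` {c} \<inter> X) u)" for y
  proof -
    have "(\<lambda>x. g (h x)) -` {y} \<inter> X = (\<Union>c\<in>{c \<in> h ` X. g c = y}. h -` {c} \<inter> X)"
      by auto
    also have "P \<dots> u = (\<Sum>c\<in>{c \<in> h ` X. g c = y}. P (h -` {c} \<inter> X) u)"
      using fin fibre_sets[OF h] by (intro P_UN) (auto simp: disjoint_family_on_def)
    finally show ?thesis .
  qed
  then have "I (\<lambda>x. g (h x)) u =
      (\<Sum>y\<in>g ` h ` X. \<Sum>c\<in>{c \<in> h ` X. g c = y}. L (g c) (P (h -` {c} \<inter> X) u))"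
    by (simp add: iq_simple_integral_def blinfun.sum_left blinfun.sum_right image_image)
  also have "\<dots> = (\<Sum>c\<in>h ` X. L (g c) (P (h -` {c} \<inter> X) u))"
    using sum.image_gen[OF fin, of "\<lambda>c. L (g c) (P (h -` {c} \<inter> X) u)" g] by simp
  finally show ?thesis .
qed

lemma I_apply:
  assumes "simple_function BX s"
  shows "I s u = (\<Sum>c\<in>s ` X. L c (P (s -` {c} \<inter> X) u))"
  using I_partition[OF assms, of "\<lambda>c. c"] by simp

text \<open>For the product, commutation of P with L gives L_p P(E) L_q P(F) = L_(pq) P(E \<inter>
  F), with the order of p and q preserved. On the common partition distinct fibres are disjoint, so
  only diagonal terms survive.\<close>

lemma
  assumes s: "simple_function BX s" and t: "simple_function BX t"
  shows I_add: "I (\<lambda>x. s x + t x) = I s + I t"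
    and I_diff: "I (\<lambda>x. s x - t x) = I s - I t"
    and I_mult: "I (\<lambda>x. s x * t x) = I s o\<^sub>L I t"
proof -
  define h where "h x = (s x, t x)" for x
  have h: "simple_function BX h"
    unfolding h_def using s t by (rule simple_function_Pair)
  have fin: "finite (h ` X)" using h by (rule image_finite)
  note part = I_partition[OF h, of fst] I_partition[OF h, of snd]
    I_partition[OF h, of "\<lambda>c. fst c + snd c"] I_partition[OF h, of "\<lambda>c. fst c - snd c"]
    I_partition[OF h, of "\<lambda>c. fst c * snd c"]
  note part = part[unfolded h_def fst_conv snd_conv, folded h_def]
  show "I (\<lambda>x. s x + t x) = I s + I t"
    by (rule blinfun_eqI) (simp add: part L_add plus_blinfun.rep_eq sum.distrib)
  show "I (\<lambda>x. s x - t x) = I s - I t"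
  proof (rule blinfun_eqI)
    have "L (p - q) v = L p v - L q v" for p q v
      using L_add[of p "- q"] by (simp add: L_minus minus_blinfun.rep_eq)
    then show "I (\<lambda>x. s x - t x) u = (I s - I t) u" for u
      by (simp add: part minus_blinfun.rep_eq sum_subtractf)
  qed
  show "I (\<lambda>x. s x * t x) = I s o\<^sub>L I t"
  proof (rule blinfun_eqI)
    fix u
    have "(\<Sum>d\<in>h ` X. L (fst c) (P (h -` {c} \<inter> X) (L (snd d) (P (h -` {d} \<inter> X) u))))
        = L (fst c * snd c) (P (h -` {c} \<inter> X) u)" if "c \<in> h ` X" for c
    proof -
      have "L (fst c) (P (h -` {c} \<inter> X) (L (snd d) (P (h -` {d} \<inter> X) u)))
          = (if d = c then L (fst c * snd c) (P (h -` {c} \<inter> X) u) else 0)" for d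
      proof -
        have "(h -` {c} \<inter> X) \<inter> (h -` {d} \<inter> X) = (if d = c then h -` {c} \<inter> X else {})"
          by auto
        then show ?thesis
          by (simp add: P_L fibre_sets[OF h] L_mult P_Int P_empty blinfun.zero_right)
      qed
      then show ?thesis using fin that by simp
    qed
    then have "I (\<lambda>x. s x * t x) u =
        (\<Sum>c\<in>h ` X. \<Sum>d\<in>h ` X. L (fst c) (P (h -` {c} \<inter> X) (L (snd d) (P (h -` {d} \<inter> X) u))))"
      by (simp add: part)
    also have "\<dots> =
        (\<Sum>d\<in>h ` X. \<Sum>c\<in>h ` X. L (fst c) (P (h -` {c} \<inter> X) (L (snd d) (P (h -` {d} \<inter> X) u))))"
      by (rule sum.swap)
    also have "\<dots> = (I s o\<^sub>L I t) u"
      by (simp add: part blinfun.sum_right)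
    finally show "I (\<lambda>x. s x * t x) u = (I s o\<^sub>L I t) u" .
  qed
qed

lemma I_adjoint:
  assumes s: "simple_function BX s"
  shows "inner (I s u) v = inner u (I (\<lambda>x. qcnj (s x)) v)"
  by (simp add: I_apply[OF s] I_partition[OF s] inner_sum_left inner_sum_right L_adjoint
      P_symmetric P_L fibre_sets[OF s])

lemma I_scaleQ:
  assumes s: "simple_function BX s"
  shows "I s (u *\<^sub>Q q) = I s u *\<^sub>Q q"
  by (simp add: I_apply[OF s] P_scaleQ fibre_sets[OF s] L_scaleQ
      linear_sum[OF bounded_linear.linear[OF bounded_linear_scaleQ_left]])

lemma X_nonempty: "X \<noteq> {}"
  by (auto simp: halfplane_def intro!: exI[of _ 0])

lemma I_const: "I (\<lambda>_. q) = L q"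
  by (rule blinfun_eqI) (simp add: I_apply X_nonempty image_constant_conv P_space)

lemma sum_P: "simple_function BX s \<Longrightarrow> (\<Sum>c\<in>s ` X. P (s -` {c} \<inter> X) u) = u"
  using I_partition[of s "\<lambda>_. 1" u] I_const[of 1] by (simp add: L_one)

text \<open>The squared norm of \<open>I s u\<close> is <u, I(|s|^2) u>, a sum of |c|^2 <u, P(E_c)
  u>. Positivity of P lets each |c|^2 be replaced by M^2, and the projections add up to the
  identity.\<close>

lemma I_norm:
  assumes s: "simple_function BX s" and le: "\<And>x. x \<in> X \<Longrightarrow> norm (s x) \<le> M"
  shows "norm (I s) \<le> M"
proof -
  have M: "M \<ge> 0"
    using X_nonempty le by (meson all_not_in_conv norm_ge_zero order_trans)
  have "norm (I s u) \<le> M * norm u" for u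
  proof -
    have cs: "simple_function BX (\<lambda>x. qcnj (s x))"
      using s by (rule simple_function_compose1)
    have "(norm (I s u))\<^sup>2 = inner u (I (\<lambda>x. qcnj (s x) * s x) u)"
      by (simp add: power2_norm_eq_inner I_adjoint[OF s] I_mult[OF cs s])
    also have "\<dots> = (\<Sum>c\<in>s ` X. inner u ((norm c)\<^sup>2 *\<^sub>R P (s -` {c} \<inter> X) u))"
      unfolding I_partition[OF s, of "\<lambda>c. qcnj c * c"] inner_sum_right
      by (simp add: qcnj_mult_self L_scaleR L_one scaleR_blinfun.rep_eq power2_norm_eq_inner)
    also have "\<dots> \<le> (\<Sum>c\<in>s ` X. inner u (M\<^sup>2 *\<^sub>R P (s -` {c} \<inter> X) u))"
      using le by (intro sum_mono)
        (auto intro!: mult_right_mono power_mono P_positive fibre_sets[OF s])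
    also have "\<dots> = inner u (M\<^sup>2 *\<^sub>R (\<Sum>c\<in>s ` X. P (s -` {c} \<inter> X) u))"
      by (simp add: inner_sum_right scaleR_sum_right)
    also have "\<dots> = (M * norm u)\<^sup>2"
      by (simp add: sum_P[OF s] power2_norm_eq_inner power_mult_distrib)
    finally show ?thesis
      using M by (auto intro: power2_le_imp_le)
  qed
  then show ?thesis
    using M by (intro norm_blinfun_bound) auto
qed

text \<open>For such a the coefficient c moves from the left of \<open>P E a\<close> to its right
  and out of the inner product. What remains is real, so only the real part of c
  contributes.\<close>

lemma I_inner_fixed:
  assumes s: "simple_function BX s" and a: "\<And>q. L q a = a *\<^sub>Q q"
  shows "inner a (I s a) = (\<Sum>c\<in>s ` X. qRe c * inner a (P (s -` {c} \<inter> X) a))"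
  unfolding I_apply[OF s] inner_sum_right
proof (rule sum.cong)
  fix c
  have "L c (P (s -` {c} \<inter> X) a) = P (s -` {c} \<inter> X) a *\<^sub>Q c"
    by (simp add: P_L[symmetric] a P_scaleQ fibre_sets[OF s])
  then have "inner a (L c (P (s -` {c} \<inter> X) a)) = qRe (qinner a (P (s -` {c} \<inter> X) a) * c)"
    by (simp only: qRe_qinner[symmetric] qinner_scaleQ_right)
  then show "inner a (L c (P (s -` {c} \<inter> X) a)) = qRe c * inner a (P (s -` {c} \<inter> X) a)"
    by (simp add: qinner_P fibre_sets[OF s])
qed simp

section \<open>The integral of bounded Borel functions as a norm limit\<close>

definition bounded_borel :: "(quat \<Rightarrow> quat) \<Rightarrow> bool"
  where "bounded_borel \<phi> \<longleftrightarrow> \<phi> \<in> borel_measurable BX \<and> bounded (\<phi> ` X)"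

abbreviation has_int :: "(quat \<Rightarrow> quat) \<Rightarrow> ('h \<Rightarrow>\<^sub>L 'h) \<Rightarrow> bool"
  where "has_int \<phi> A \<equiv> iq_has_integral \<iota> P L \<phi> A"

lemma has_intE:
  assumes "has_int \<phi> A"
  obtains s where "\<And>n. simple_function BX (s n)" "uniform_limit X s \<phi> sequentially" "(\<lambda>n. I (s n)) \<longlonglongrightarrow> A"
  using assms unfolding iq_has_integral_def by blast

lemma has_intI:
  assumes "\<And>n. simple_function BX (s n)" "uniform_limit X s \<phi> sequentially" "(\<lambda>n. I (s n)) \<longlonglongrightarrow> A"
  shows "has_int \<phi> A"
  using assms unfolding iq_has_integral_def by blast

text \<open>Two sequences and two indices serve both purposes: s = t gives the Cauchy property
  behind existence, m = n gives independence of the approximating sequence.\<close>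

lemma I_diff_eventually_small:
  assumes s: "\<And>n. simple_function BX (s n)" "uniform_limit X s \<phi> sequentially"
    and t: "\<And>n. simple_function BX (t n)" "uniform_limit X t \<phi> sequentially" and "e > 0"
  shows "\<exists>K. \<forall>m\<ge>K. \<forall>n\<ge>K. norm (I (s m) - I (t n)) < e"
proof -
  have "eventually (\<lambda>n. (\<forall>x\<in>X. dist (s n x) (\<phi> x) < e / 4) \<and> (\<forall>x\<in>X. dist (t n x) (\<phi> x) < e / 4)) sequentially"
    using s(2) t(2) \<open>e > 0\<close> by (intro eventually_conj uniform_limitD) auto
  then obtain K where K: "\<And>n x. n \<ge> K \<Longrightarrow> x \<in> X \<Longrightarrow> dist (s n x) (\<phi> x) < e / 4 \<and> dist (t n x) (\<phi> x) < e / 4"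
    by (auto simp: eventually_sequentially)
  have "norm (I (s m) - I (t n)) < e" if "m \<ge> K" "n \<ge> K" for m n
  proof -
    have "norm (s m x - t n x) \<le> e / 2" if "x \<in> X" for x
      using K[OF \<open>m \<ge> K\<close> that] K[OF \<open>n \<ge> K\<close> that] dist_triangle_half_l[of "s m x" "\<phi> x" "e / 2" "t n x"]
      by (simp add: dist_norm)
    then have "norm (I (\<lambda>x. s m x - t n x)) \<le> e / 2"
      by (intro I_norm simple_function_diff s t)
    then show ?thesis
      using \<open>e > 0\<close> by (simp add: I_diff s t)
  qed
  then show ?thesis by blast
qed

lemma I_diff_tendsto_zero:
  assumes s: "\<And>n. simple_function BX (s n)" "uniform_limit X s \<phi> sequentially"
    and t: "\<And>n. simple_function BX (t n)" "uniform_limit X t \<phi> sequentially"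
  shows "(\<lambda>n. I (s n) - I (t n)) \<longlonglongrightarrow> 0"
proof (rule LIMSEQ_I)
  fix e :: real assume "e > 0"
  then obtain K where "\<forall>m\<ge>K. \<forall>n\<ge>K. norm (I (s m) - I (t n)) < e"
    using I_diff_eventually_small[OF s t] by blast
  then show "\<exists>K. \<forall>n\<ge>K. norm (I (s n) - I (t n) - 0) < e"
    by (intro exI[of _ K]) simp
qed

lemma has_int_unique:
  assumes "has_int \<phi> A" "has_int \<phi> B"
  shows "A = B"
proof -
  obtain s where s: "\<And>n. simple_function BX (s n)" "uniform_limit X s \<phi> sequentially" "(\<lambda>n. I (s n)) \<longlonglongrightarrow> A"
    by (rule has_intE[OF assms(1)]) (rule that)
  obtain t where t: "\<And>n. simple_function BX (t n)" "uniform_limit X t \<phi> sequentially" "(\<lambda>n. I (t n)) \<longlonglongrightarrow> B"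
    by (rule has_intE[OF assms(2)]) (rule that)
  have "(\<lambda>n. I (s n) - I (t n)) \<longlonglongrightarrow> 0"
    by (rule I_diff_tendsto_zero[OF s(1,2) t(1,2)])
  moreover have "(\<lambda>n. I (s n) - I (t n)) \<longlonglongrightarrow> A - B"
    by (intro tendsto_diff s t)
  ultimately show ?thesis
    using LIMSEQ_unique[of _ "A - B" 0] by simp
qed

lemma has_int_exists:
  assumes "bounded_borel \<phi>"
  obtains A where "has_int \<phi> A"
proof -
  obtain s where s: "\<And>n. simple_function BX (s n)" "uniform_limit X s \<phi> sequentially"
    using uniform_simple_approximation[of \<phi> BX] assms
    by (auto simp: bounded_borel_def space_restrict_space)
  have "Cauchy (\<lambda>n. I (s n))"
    using I_diff_eventually_small[OF s s] by (auto simp: Cauchy_def dist_norm)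
  then obtain A where "(\<lambda>n. I (s n)) \<longlonglongrightarrow> A"
    using Cauchy_convergent convergent_def by blast
  with s show thesis
    by (intro that has_intI)
qed

lemma has_int_add:
  assumes "has_int \<phi> A" "has_int \<psi> B"
  shows "has_int (\<lambda>x. \<phi> x + \<psi> x) (A + B)"
proof -
  obtain s where s: "\<And>n. simple_function BX (s n)" "uniform_limit X s \<phi> sequentially" "(\<lambda>n. I (s n)) \<longlonglongrightarrow> A"
    by (rule has_intE[OF assms(1)]) (rule that)
  obtain t where t: "\<And>n. simple_function BX (t n)" "uniform_limit X t \<psi> sequentially" "(\<lambda>n. I (t n)) \<longlonglongrightarrow> B"
    by (rule has_intE[OF assms(2)]) (rule that)
  show ?thesis
    by (rule has_intI[of "\<lambda>n x. s n x + t n x"])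
      (auto intro!: uniform_limit_add tendsto_add s t simp: I_add[OF s(1) t(1)])
qed

lemma has_int_mult:
  assumes "has_int \<phi> A" "has_int \<psi> B" "bounded (\<phi> ` X)" "bounded (\<psi> ` X)"
  shows "has_int (\<lambda>x. \<phi> x * \<psi> x) (A o\<^sub>L B)"
proof -
  obtain s where s: "\<And>n. simple_function BX (s n)" "uniform_limit X s \<phi> sequentially" "(\<lambda>n. I (s n)) \<longlonglongrightarrow> A"
    by (rule has_intE[OF assms(1)]) (rule that)
  obtain t where t: "\<And>n. simple_function BX (t n)" "uniform_limit X t \<psi> sequentially" "(\<lambda>n. I (t n)) \<longlonglongrightarrow> B"
    by (rule has_intE[OF assms(2)]) (rule that)
  show ?thesis
    by (rule has_intI[of "\<lambda>n x. s n x * t n x"])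
      (auto intro!: uniform_lim_mult bounded_bilinear.tendsto[OF bounded_bilinear_blinfun_compose]
        s t assms simp: I_mult[OF s(1) t(1)])
qed

lemma has_int_adjoint:
  assumes "has_int \<phi> A" "has_int (\<lambda>x. qcnj (\<phi> x)) B"
  shows "inner (A u) v = inner u (B v)"
proof -
  obtain s where s: "\<And>n. simple_function BX (s n)" "uniform_limit X s \<phi> sequentially" "(\<lambda>n. I (s n)) \<longlonglongrightarrow> A"
    by (rule has_intE[OF assms(1)]) (rule that)
  have [simp]: "simple_function BX (\<lambda>x. qcnj (s n x))" for n
    using s(1) by (rule simple_function_compose1)
  have diff: "qcnj p - qcnj q = qcnj (p - q)" for p q by (simp add: quat_eq_iff)
  have "uniform_limit X (\<lambda>n x. qcnj (s n x)) (\<lambda>x. qcnj (\<phi> x)) sequentially"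
    using s(2) by (simp add: uniform_limit_iff dist_norm diff)
  moreover obtain t where t: "\<And>n. simple_function BX (t n)"
    "uniform_limit X t (\<lambda>x. qcnj (\<phi> x)) sequentially" "(\<lambda>n. I (t n)) \<longlonglongrightarrow> B"
    by (rule has_intE[OF assms(2)]) (rule that)
  \<comment> \<open>\<open>B\<close> is a limit along some approximation \<open>t\<close> of the
    conjugate function, not necessarily along the conjugates of \<open>s\<close>; the two differ by
    a null sequence.\<close>
  ultimately have "(\<lambda>n. I (\<lambda>x. qcnj (s n x)) - I (t n)) \<longlonglongrightarrow> 0"
    by (intro I_diff_tendsto_zero[of "\<lambda>n x. qcnj (s n x)" "\<lambda>x. qcnj (\<phi> x)" t]) auto
  from tendsto_add[OF this t(3)] have lim: "(\<lambda>n. I (\<lambda>x. qcnj (s n x))) \<longlonglongrightarrow> B" by simp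
  have "(\<lambda>n. inner (I (s n) u) v) \<longlonglongrightarrow> inner (A u) v"
    by (intro tendsto_inner tendsto_const blinfun.tendsto s)
  moreover have "(\<lambda>n. inner (I (s n) u) v) \<longlonglongrightarrow> inner u (B v)"
    unfolding I_adjoint[OF s(1)] by (intro tendsto_inner tendsto_const blinfun.tendsto lim)
  ultimately show ?thesis by (rule LIMSEQ_unique)
qed

lemma has_int_scaleQ:
  assumes "has_int \<phi> A"
  shows "A (u *\<^sub>Q q) = A u *\<^sub>Q q"
proof -
  obtain s where s: "\<And>n. simple_function BX (s n)" "uniform_limit X s \<phi> sequentially" "(\<lambda>n. I (s n)) \<longlonglongrightarrow> A"
    by (rule has_intE[OF assms]) (rule that)
  have "(\<lambda>n. I (s n) (u *\<^sub>Q q)) \<longlonglongrightarrow> A (u *\<^sub>Q q)"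
    by (intro blinfun.tendsto s tendsto_const)
  moreover have "(\<lambda>n. I (s n) (u *\<^sub>Q q)) \<longlonglongrightarrow> A u *\<^sub>Q q"
    unfolding I_scaleQ[OF s(1)]
    by (intro bounded_linear.tendsto[OF bounded_linear_scaleQ_left] blinfun.tendsto s tendsto_const)
  ultimately show ?thesis by (rule LIMSEQ_unique)
qed

lemma has_int_simple:
  assumes "simple_function BX s"
  shows "has_int s (I s)"
  using assms by (intro has_intI[of "\<lambda>_. s"]) (simp_all add: uniform_limit_const)

end

lemma qRe_eq_inner: "qRe q = inner q 1"
  by (simp add: inner_quat_def)

lemma bounded_linear_qRe: "bounded_linear qRe"
  unfolding qRe_eq_inner[abs_def] by (rule bounded_linear_inner_left)

lemma bounded_linear_qcnj: "bounded_linear qcnj"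
  by (rule bounded_linear_intro[where K = 1]) (simp_all add: quat_eq_iff[of "qcnj _"])

lemma borel_measurable_qRe [measurable (raw)]:
  "f \<in> borel_measurable M \<Longrightarrow> (\<lambda>x. qRe (f x)) \<in> borel_measurable M"
  using measurable_compose[OF _ borel_measurable_continuous_onI[OF linear_continuous_on[OF bounded_linear_qRe]]] .

lemma borel_measurable_qcnj [measurable (raw)]:
  "f \<in> borel_measurable M \<Longrightarrow> (\<lambda>x. qcnj (f x)) \<in> borel_measurable M"
  using measurable_compose[OF _ borel_measurable_continuous_onI[OF linear_continuous_on[OF bounded_linear_qcnj]]] .

lemma (in finite_measure) integral_uniform_limit:
  fixes f :: "'a \<Rightarrow> 'b::{banach, second_countable_topology}"
  assumes [measurable]: "\<And>n. s n \<in> borel_measurable M" "f \<in> borel_measurable M"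
    and bdd: "bounded (f ` space M)" and lim: "uniform_limit (space M) s f sequentially"
  shows "(\<lambda>n. integral\<^sup>L M (s n)) \<longlonglongrightarrow> integral\<^sup>L M f"
proof -
  obtain C where C: "\<And>x. x \<in> space M \<Longrightarrow> norm (f x) \<le> C"
    using bdd by (auto simp: bounded_iff)
  obtain K where K: "\<And>n x. n \<ge> K \<Longrightarrow> x \<in> space M \<Longrightarrow> dist (s n x) (f x) < 1"
    using uniform_limitD[OF lim, of 1] by (auto simp: eventually_sequentially)
  \<comment> \<open>Uniform closeness bounds \<open>s n\<close> by C + 1 only from index K on, so
    the earlier terms are shifted away before dominated convergence.\<close>
  have "(\<lambda>n. integral\<^sup>L M (s (n + K))) \<longlonglongrightarrow> integral\<^sup>L M f"
  proof (rule integral_dominated_convergence[where w = "\<lambda>_. C + 1"])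
    show "AE x in M. (\<lambda>n. s (n + K) x) \<longlonglongrightarrow> f x"
      using lim by (intro AE_I2 LIMSEQ_ignore_initial_segment) (rule tendsto_uniform_limitI)
    show "AE x in M. norm (s (n + K) x) \<le> C + 1" for n
    proof (rule AE_I2)
      fix x assume x: "x \<in> space M"
      have "norm (s (n + K) x) \<le> norm (f x) + norm (s (n + K) x - f x)"
        using norm_triangle_ineq[of "f x" "s (n + K) x - f x"] by simp
      then show "norm (s (n + K) x) \<le> C + 1"
        using C[OF x] K[of "n + K" x] x by (simp add: dist_norm)
    qed
  qed auto
  then show ?thesis by (rule LIMSEQ_offset)
qed

context intertwining_pvm
begin

section \<open>The support and the functional calculus on it\<close>

abbreviation "G \<equiv> qsupp \<iota> P"
abbreviation "BG \<equiv> restrict_space borel G"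

lemma openin_X_sets: "openin (top_of_set X) U \<Longrightarrow> U \<in> sets BX"
  by (auto simp: openin_open sets_restrict_space)

lemma X_minus_G: "X - G = \<Union>{U. openin (top_of_set X) U \<and> P U = 0}"
  using openin_imp_subset by (fastforce simp: qsupp_def)

lemma G_sets: "G \<in> sets BX"
proof -
  have "X - G \<in> sets BX"
    unfolding X_minus_G by (intro openin_X_sets openin_Union) auto
  then have "space BX - (X - G) \<in> sets BX"
    by (rule sets.compl_sets)
  moreover have "space BX - (X - G) = G"
    by (auto simp: space_restrict_space qsupp_def)
  ultimately show ?thesis by simp
qed

lemma G_subset: "G \<subseteq> X"
  by (auto simp: qsupp_def)

lemma space_BG: "space BG = G"
  by (simp add: space_restrict_space)

lemma sets_BG_restrict: "sets BG = sets (restrict_space BX G)"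
  using G_subset by (simp add: sets_restrict_restrict_space Int_absorb1)

lemma sets_BG: "E \<in> sets BG \<longleftrightarrow> E \<in> sets BX \<and> E \<subseteq> G"
  unfolding sets_BG_restrict by (subst sets_restrict_space_iff) (use G_sets G_subset in \<open>auto simp: space_restrict_space Int_absorb2\<close>)

text \<open>After making the sets disjoint, each piece lies in a null set of P, so its projection
  factors through 0; countable additivity then applies.\<close>

lemma P_countable_Union_null:
  assumes F: "countable F" "F \<subseteq> sets BX" "\<And>E. E \<in> F \<Longrightarrow> P E = 0"
  shows "P (\<Union>F) u = 0"
proof (cases "F = {}")
  case False
  define f where "f = from_nat_into F"
  have f: "range f = F"
    using False F(1) by (simp add: f_def range_from_nat_into)
  have sets: "range f \<subseteq> sets BX" using f F(2) by simp
  have "P (disjointed f n) u = 0" for n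
  proof -
    have "P (disjointed f n) u = P (disjointed f n) (P (f n) u)"
      using sets.range_disjointed_sets[OF sets] sets disjointed_subset[of f n]
      by (subst P_Int) (auto simp: Int_absorb2)
    also have "P (f n) = 0" using F(3) f by auto
    finally show ?thesis by (simp add: blinfun.zero_right)
  qed
  moreover have "(\<lambda>n. P (disjointed f n) u) sums P (\<Union>n. disjointed f n) u"
    using sets.range_disjointed_sets[OF sets] by (rule P_sums) (rule disjoint_family_disjointed)
  ultimately show ?thesis
    using sums_unique2[OF _ sums_zero] by (auto simp: UN_disjointed_eq f)
qed (simp add: P_empty)

text \<open>The complement is a possibly uncountable union of open null sets, where countable
  additivity says nothing. The Lindelof property reduces it to a countable union.\<close>

lemma P_outside_support: "P (X - G) u = 0"
proof -
  obtain F where F: "F \<subseteq> {U. openin (top_of_set X) U \<and> P U = 0}" "countable F"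
    "\<Union>F = \<Union>{U. openin (top_of_set X) U \<and> P U = 0}"
    by (rule Lindelof_openin[of "{U. openin (top_of_set X) U \<and> P U = 0}" X]) auto
  then have "P (\<Union>F) u = 0"
    by (intro P_countable_Union_null) (auto intro: openin_X_sets)
  then show ?thesis by (simp add: X_minus_G F(3))
qed

lemma P_Int_support:
  assumes E: "E \<in> sets BX"
  shows "P (E \<inter> G) u = P E u"
proof -
  have XG: "X - G \<in> sets BX"
    using sets.compl_sets[OF G_sets] by (simp add: space_restrict_space)
  have "E \<subseteq> X" using sets.sets_into_space[OF E] by (simp add: space_restrict_space)
  then have "E = (E \<inter> G) \<union> (E \<inter> (X - G))" by blast
  then have "P E u = P (E \<inter> G) u + P (E \<inter> (X - G)) u"
    using P_Un[of "E \<inter> G" "E \<inter> (X - G)" u] E XG G_sets by auto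
  then show ?thesis
    using P_Int[OF E XG, of u] by (simp add: P_outside_support blinfun.zero_right)
qed

definition test_fun :: "(quat \<Rightarrow> quat) \<Rightarrow> bool"
  where "test_fun \<phi> \<longleftrightarrow> \<phi> \<in> borel_measurable BG \<and> bounded (\<phi> ` G)"

abbreviation \<Phi> :: "(quat \<Rightarrow> quat) \<Rightarrow> ('h \<Rightarrow>\<^sub>L 'h)"
  where "\<Phi> \<equiv> iq_integral \<iota> P L"

lemma test_fun_const [simp]: "test_fun (\<lambda>_. q)"
  by (simp add: test_fun_def image_constant_conv)

lemma test_fun_add: "test_fun \<phi> \<Longrightarrow> test_fun \<psi> \<Longrightarrow> test_fun (\<lambda>x. \<phi> x + \<psi> x)"
  unfolding test_fun_def by (auto intro: bounded_plus_comp)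

lemma test_fun_mult:
  assumes "test_fun \<phi>" "test_fun \<psi>"
  shows "test_fun (\<lambda>x. \<phi> x * \<psi> x)"
proof -
  obtain C D where "\<And>x. x \<in> G \<Longrightarrow> norm (\<phi> x) \<le> C" "\<And>x. x \<in> G \<Longrightarrow> norm (\<psi> x) \<le> D"
    using assms by (auto simp: test_fun_def bounded_iff)
  then have "norm (\<phi> x * \<psi> x) \<le> C * D" if "x \<in> G" for x
    using that unfolding norm_mult by (meson mult_mono norm_ge_zero order_trans)
  then show ?thesis
    using assms by (auto simp: test_fun_def bounded_iff)
qed

lemma test_fun_qcnj: "test_fun \<phi> \<Longrightarrow> test_fun (\<lambda>x. qcnj (\<phi> x))"
  by (auto simp: test_fun_def bounded_iff)

text \<open>The integrand that \<open>iq_integral\<close> really uses. Extension by 0 commutes with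
  sums, products and conjugation, so the rules of the calculus carry over to functions known only on
  the support.\<close>

definition ext :: "(quat \<Rightarrow> quat) \<Rightarrow> quat \<Rightarrow> quat"
  where "ext \<phi> x = (if x \<in> G then \<phi> x else 0)"

lemma bounded_ext: "bounded (\<phi> ` G) \<Longrightarrow> bounded (ext \<phi> ` X)"
proof -
  assume "bounded (\<phi> ` G)"
  then have "bounded (insert 0 (\<phi> ` G))" by simp
  then show "bounded (ext \<phi> ` X)"
    by (rule bounded_subset) (auto simp: ext_def)
qed

lemma bounded_borel_ext: "test_fun \<phi> \<Longrightarrow> bounded_borel (ext \<phi>)"
proof -
  assume \<phi>: "test_fun \<phi>"
  have "G \<inter> space BX \<in> sets BX"
    using G_sets G_subset by (simp add: space_restrict_space Int_absorb2)
  from measurable_restrict_space_iff[OF this, of 0 borel \<phi>]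
  have "ext \<phi> \<in> borel_measurable BX"
    using \<phi> by (simp add: test_fun_def ext_def[abs_def] measurable_cong_sets[OF sets_BG_restrict refl])
  then show "bounded_borel (ext \<phi>)"
    using \<phi> bounded_ext by (simp add: bounded_borel_def test_fun_def)
qed

lemma \<Phi>_eqI: "has_int (ext \<phi>) A \<Longrightarrow> \<Phi> \<phi> = A"
  unfolding iq_integral_def
  by (rule the_equality) (auto simp: ext_def[abs_def] intro: has_int_unique)

lemma has_int_\<Phi>: "test_fun \<phi> \<Longrightarrow> has_int (ext \<phi>) (\<Phi> \<phi>)"
  by (rule has_int_exists[OF bounded_borel_ext]) (auto simp: \<Phi>_eqI)

lemma \<Phi>_add:
  assumes "test_fun \<phi>" "test_fun \<psi>"
  shows "\<Phi> (\<lambda>x. \<phi> x + \<psi> x) = \<Phi> \<phi> + \<Phi> \<psi>"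
proof (rule \<Phi>_eqI)
  have "(\<lambda>x. ext \<phi> x + ext \<psi> x) = ext (\<lambda>x. \<phi> x + \<psi> x)"
    by (auto simp: ext_def)
  then show "has_int (ext (\<lambda>x. \<phi> x + \<psi> x)) (\<Phi> \<phi> + \<Phi> \<psi>)"
    using has_int_add[OF has_int_\<Phi> has_int_\<Phi>, OF assms] by simp
qed

lemma \<Phi>_mult:
  assumes "test_fun \<phi>" "test_fun \<psi>"
  shows "\<Phi> (\<lambda>x. \<phi> x * \<psi> x) u = \<Phi> \<phi> (\<Phi> \<psi> u)"
proof -
  have "(\<lambda>x. ext \<phi> x * ext \<psi> x) = ext (\<lambda>x. \<phi> x * \<psi> x)"
    by (auto simp: ext_def)
  then have "has_int (ext (\<lambda>x. \<phi> x * \<psi> x)) (\<Phi> \<phi> o\<^sub>L \<Phi> \<psi>)"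
    using has_int_mult[OF has_int_\<Phi> has_int_\<Phi> bounded_ext bounded_ext, OF assms] assms
    by (simp add: test_fun_def)
  then show ?thesis
    using \<Phi>_eqI by simp
qed

lemma \<Phi>_adjoint:
  assumes "test_fun \<phi>"
  shows "inner (\<Phi> \<phi> u) v = inner u (\<Phi> (\<lambda>x. qcnj (\<phi> x)) v)"
proof -
  have "ext (\<lambda>x. qcnj (\<phi> x)) = (\<lambda>x. qcnj (ext \<phi> x))"
    by (auto simp: ext_def quat_eq_iff)
  then show ?thesis
    using has_int_adjoint[OF has_int_\<Phi>[OF assms], of "\<Phi> (\<lambda>x. qcnj (\<phi> x))"]
      has_int_\<Phi>[OF test_fun_qcnj[OF assms]] by simp
qed

lemma \<Phi>_scaleQ: "test_fun \<phi> \<Longrightarrow> \<Phi> \<phi> (u *\<^sub>Q q) = \<Phi> \<phi> u *\<^sub>Q q"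
  by (rule has_int_scaleQ[OF has_int_\<Phi>])

text \<open>The extension by 0 of a constant is no longer constant, but it differs from the constant
  only off the support, where P vanishes. This places \<open>L q\<close> inside the functional
  calculus.\<close>

lemma \<Phi>_const: "\<Phi> (\<lambda>_. q) = L q"
proof (rule \<Phi>_eqI)
  \<comment> \<open>Membership in \<open>G\<close> is taken as a two-valued simple function, so that
    both integrands are sums over the same two fibres.\<close>
  have h: "simple_function BX (\<lambda>x. x \<in> G)"
    using simple_function_compose1[OF simple_function_indicator[OF G_sets], of "\<lambda>r. r = (1::real)"]
    by (simp add: indicator_def)
  define g where "g b = (if b then q else 0)" for b
  have eq: "ext (\<lambda>_. q) = (\<lambda>x. g (x \<in> G))"
    by (auto simp: ext_def g_def)
  have "I (\<lambda>x. g (x \<in> G)) u = I (\<lambda>x. (\<lambda>_. q) (x \<in> G)) u" for u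
    unfolding I_partition[OF h, of g] I_partition[OF h, of "\<lambda>_. q"]
  proof (rule sum.cong)
    fix b
    have "(\<lambda>x. x \<in> G) -` {False} \<inter> X = X - G" by auto
    then show "L (g b) (P ((\<lambda>x. x \<in> G) -` {b} \<inter> X) u) = L q (P ((\<lambda>x. x \<in> G) -` {b} \<inter> X) u)"
      by (cases b) (simp_all add: g_def P_outside_support blinfun.zero_right)
  qed simp
  then have "I (ext (\<lambda>_. q)) = L q"
    by (intro blinfun_eqI) (simp add: eq I_const)
  then show "has_int (ext (\<lambda>_. q)) (L q)"
    using has_int_simple[OF simple_function_compose1[OF h, of g]] by (simp add: eq)
qed

section \<open>The scalar measures and the inner products of cyclic vectors\<close>

definition \<nu> :: "'h \<Rightarrow> quat measure"
  where "\<nu> a = measure_of G (sets BG) (\<lambda>E. ennreal (inner a (P E a)))"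

lemma space_\<nu> [simp]: "space (\<nu> a) = G"
  and sets_\<nu> [simp, measurable_cong]: "sets (\<nu> a) = sets BG"
  using sets.space_closed[of BG] sets.sigma_sets_eq[of BG] by (simp_all add: \<nu>_def space_BG)

lemma emeasure_\<nu>:
  assumes "E \<in> sets BG"
  shows "emeasure (\<nu> a) E = ennreal (inner a (P E a))"
  unfolding \<nu>_def
proof (rule emeasure_measure_of_sigma)
  show "sigma_algebra G (sets BG)"
    using sets.sigma_algebra_axioms[of BG] by (simp add: space_BG)
  show "positive (sets BG) (\<lambda>E. ennreal (inner a (P E a)))"
    by (simp add: positive_def P_empty)
  show "countably_additive (sets BG) (\<lambda>E. ennreal (inner a (P E a)))"
  proof (rule countably_additiveI)
    fix E :: "nat \<Rightarrow> quat set"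
    assume E: "range E \<subseteq> sets BG" "disjoint_family E"
    then have ran: "range E \<subseteq> sets BX" by (auto simp: sets_BG)
    have sums: "(\<lambda>n. inner a (P (E n) a)) sums inner a (P (\<Union>n. E n) a)"
      by (rule bounded_linear.sums[OF bounded_linear_inner_right P_sums[OF ran E(2)]])
    then show "(\<Sum>n. ennreal (inner a (P (E n) a))) = ennreal (inner a (P (\<Union>n. E n) a))"
      using ran P_positive by (subst suminf_ennreal2) (auto simp: sums_iff)
  qed
qed (fact assms)

lemma finite_measure_\<nu>: "finite_measure (\<nu> a)"
proof
  show "emeasure (\<nu> a) (space (\<nu> a)) \<noteq> \<infinity>"
    using emeasure_\<nu>[of G a] sets.top[of BG] by (simp add: space_BG)
qed

lemma measure_\<nu>: "E \<in> sets BG \<Longrightarrow> measure (\<nu> a) E = inner a (P E a)"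
  using emeasure_\<nu>[of E a] P_positive[of E a] by (simp add: measure_def sets_BG)

text \<open>The fibres of s lie in the half-plane, the measure lives on \<open>G\<close>; cutting a
  fibre down to \<open>G\<close> does not change its projection.\<close>

lemma I_inner_integral:
  assumes s: "simple_function BX s" and a: "\<And>q. L q a = a *\<^sub>Q q"
  shows "inner a (I s a) = (\<integral>x. qRe (s x) \<partial>\<nu> a)"
proof -
  interpret finite_measure "\<nu> a" by (rule finite_measure_\<nu>)
  have sets: "s -` {c} \<inter> G \<in> sets BG" for c
  proof -
    have "s -` {c} \<inter> G = (s -` {c} \<inter> X) \<inter> G" using G_subset by auto
    then show ?thesis using fibre_sets[OF s, of c] G_sets by (auto simp: sets_BG)
  qed
  have "(\<integral>x. qRe (s x) \<partial>\<nu> a) = (\<integral>x. (\<Sum>c\<in>s ` X. qRe c * indicator (s -` {c} \<inter> G) x) \<partial>\<nu> a)"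
  proof (rule Bochner_Integration.integral_cong)
    fix x assume "x \<in> space (\<nu> a)"
    then have x: "x \<in> G" "s x \<in> s ` X" using G_subset by auto
    have "(\<Sum>c\<in>s ` X. qRe c * indicator (s -` {c} \<inter> G) x) = (\<Sum>c\<in>s ` X. if c = s x then qRe c else 0)"
      using x by (intro sum.cong) (auto simp: indicator_def)
    then show "qRe (s x) = (\<Sum>c\<in>s ` X. qRe c * indicator (s -` {c} \<inter> G) x)"
      using x image_finite[OF s] by simp
  qed simp
  also have "\<dots> = (\<Sum>c\<in>s ` X. qRe c * measure (\<nu> a) (s -` {c} \<inter> G))"
    using sets by (subst Bochner_Integration.integral_sum)
      (auto intro!: integrable_real_indicator sum.cong simp: emeasure_finite less_top[symmetric])
  also have "\<dots> = (\<Sum>c\<in>s ` X. qRe c * inner a (P (s -` {c} \<inter> X) a))"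
  proof (rule sum.cong)
    fix c
    have "(s -` {c} \<inter> X) \<inter> G = s -` {c} \<inter> G" using G_subset by auto
    then have "P (s -` {c} \<inter> X) a = P (s -` {c} \<inter> G) a"
      using P_Int_support[OF fibre_sets[OF s, of c], of a] by simp
    then show "qRe c * measure (\<nu> a) (s -` {c} \<inter> G) = qRe c * inner a (P (s -` {c} \<inter> X) a)"
      by (simp add: measure_\<nu> sets)
  qed simp
  finally show ?thesis by (simp add: I_inner_fixed[OF s a])
qed

lemma \<Phi>_inner_integral:
  assumes \<phi>: "test_fun \<phi>" and a: "\<And>q. L q a = a *\<^sub>Q q"
  shows "inner a (\<Phi> \<phi> a) = (\<integral>x. qRe (\<phi> x) \<partial>\<nu> a)"
proof -
  interpret finite_measure "\<nu> a" by (rule finite_measure_\<nu>)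
  obtain s where s: "\<And>n. simple_function BX (s n)" "uniform_limit X s (ext \<phi>) sequentially"
    "(\<lambda>n. I (s n)) \<longlonglongrightarrow> \<Phi> \<phi>"
    by (rule has_intE[OF has_int_\<Phi>[OF \<phi>]]) (rule that)
  have ms: "s n \<in> borel_measurable (\<nu> a)" for n
  proof -
    have "s n \<in> borel_measurable BG"
      unfolding measurable_cong_sets[OF sets_BG_restrict refl]
      by (intro measurable_restrict_space1 borel_measurable_simple_function s)
    then show ?thesis by (simp cong: measurable_cong_sets)
  qed
  have m\<phi>: "\<phi> \<in> borel_measurable (\<nu> a)"
    using \<phi> by (simp add: test_fun_def cong: measurable_cong_sets)
  have "uniform_limit G s (ext \<phi>) sequentially"
    using s(2) G_subset by (rule uniform_limit_on_subset)
  then have "uniform_limit G s \<phi> sequentially"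
    by (rule uniform_limit_cong'[THEN iffD1, rotated -1]) (auto simp: ext_def)
  then have "uniform_limit G (\<lambda>n x. qRe (s n x)) (\<lambda>x. qRe (\<phi> x)) sequentially"
    by (rule bounded_linear.uniform_limit[OF bounded_linear_qRe])
  moreover have "bounded ((\<lambda>x. qRe (\<phi> x)) ` G)"
    using bounded_linear_image[OF _ bounded_linear_qRe, of "\<phi> ` G"] \<phi>
    by (simp add: test_fun_def image_image)
  ultimately have "(\<lambda>n. \<integral>x. qRe (s n x) \<partial>\<nu> a) \<longlonglongrightarrow> (\<integral>x. qRe (\<phi> x) \<partial>\<nu> a)"
    using ms m\<phi> by (intro integral_uniform_limit) auto
  moreover have "(\<lambda>n. \<integral>x. qRe (s n x) \<partial>\<nu> a) \<longlonglongrightarrow> inner a (\<Phi> \<phi> a)"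
    unfolding I_inner_integral[OF s(1) a, symmetric]
    by (intro tendsto_inner tendsto_const blinfun.tendsto s)
  ultimately show ?thesis
    using LIMSEQ_unique by blast
qed

text \<open>Adjoint and product rule collect both operators into the calculus of the conjugate of
  \<phi> times \<psi>, whose real part is the pointwise inner product. This is the isometry on test
  functions.\<close>

lemma inner_\<Phi>_\<Phi>:
  assumes "test_fun \<phi>" "test_fun \<psi>" and a: "\<And>q. L q a = a *\<^sub>Q q"
  shows "inner (\<Phi> \<phi> a) (\<Phi> \<psi> a) = (\<integral>x. inner (\<phi> x) (\<psi> x) \<partial>\<nu> a)"
  using assms \<Phi>_inner_integral[OF test_fun_mult[OF test_fun_qcnj, of \<phi> \<psi>] a]
  by (simp add: \<Phi>_adjoint \<Phi>_mult test_fun_qcnj inner_quat_eq_qRe)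

end

section \<open>Cyclic vectors\<close>

lemma quat_expand: "q = qRe q *\<^sub>R 1 + qI q *\<^sub>R Quat 0 1 0 0 + qJ q *\<^sub>R Quat 0 0 1 0 + qK q *\<^sub>R Quat 0 0 0 1"
  by (simp add: quat_eq_iff)

context left_multiplication
begin

text \<open>In the basis \<open>N\<close> these are the vectors whose coefficients <z, a> commute
  with every quaternion, that is, are real.\<close>

definition intertwines :: "'h \<Rightarrow> bool"
  where "intertwines a \<longleftrightarrow> (\<forall>q. L q a = a *\<^sub>Q q)"

text \<open>For the four units the conjugate is the inverse. In a coordinate x = <z, w> with z in
  \<open>N\<close> the sum of e x e^-1 is four times the real part of x, so this is four times the
  projection onto the vectors with real coordinates.\<close>

definition qaverage :: "'h \<Rightarrow> 'h"
  where "qaverage w = (\<Sum>e\<in>Basis. L e (w *\<^sub>Q qcnj e))"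

text \<open>In the tensor product of the quaternions with themselves, the sum of (q e) \<otimes> e'
  over the units e with conjugates e' equals the sum of e \<otimes> (e' q). Applying the real
  bilinear map \<open>B\<close> gives the claim.\<close>

lemma qaverage_intertwines: "intertwines (qaverage w)"
  unfolding intertwines_def
proof
  fix q
  define B where "B x y = L x (w *\<^sub>Q y)" for x y
  have B_left: "B x y = qRe x *\<^sub>R B 1 y + qI x *\<^sub>R B (Quat 0 1 0 0) y + qJ x *\<^sub>R B (Quat 0 0 1 0) y
      + qK x *\<^sub>R B (Quat 0 0 0 1) y" for x y
    unfolding B_def by (subst quat_expand[of x])
      (simp only: L_add L_scaleR plus_blinfun.rep_eq scaleR_blinfun.rep_eq)
  have B_right: "B x y = qRe y *\<^sub>R B x 1 + qI y *\<^sub>R B x (Quat 0 1 0 0) + qJ y *\<^sub>R B x (Quat 0 0 1 0)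
      + qK y *\<^sub>R B x (Quat 0 0 0 1)" for x y
    unfolding B_def by (subst quat_expand[of y])
      (simp only: scaleQ_add_right scaleQ_scaleR_right blinfun.add_right blinfun.scaleR_right)
  \<comment> \<open>\<open>M i j\<close> is the value of \<open>B\<close> at the units with numbers
    i and j; in terms of these sixteen vectors the tensor identity becomes a comparison of real
    coefficients.\<close>
  obtain M where M: "\<And>x y. B x y =
      qRe x *\<^sub>R (qRe y *\<^sub>R M 0 0 + qI y *\<^sub>R M 0 1 + qJ y *\<^sub>R M 0 2 + qK y *\<^sub>R M 0 (3::nat)) +
      qI x *\<^sub>R (qRe y *\<^sub>R M 1 0 + qI y *\<^sub>R M 1 1 + qJ y *\<^sub>R M 1 2 + qK y *\<^sub>R M 1 3) +
      qJ x *\<^sub>R (qRe y *\<^sub>R M 2 0 + qI y *\<^sub>R M 2 1 + qJ y *\<^sub>R M 2 2 + qK y *\<^sub>R M 2 3) +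
      qK x *\<^sub>R (qRe y *\<^sub>R M (3::nat) 0 + qI y *\<^sub>R M 3 1 + qJ y *\<^sub>R M 3 2 + qK y *\<^sub>R M 3 3)"
  proof (rule that)
    define e where "e n = [1, Quat 0 1 0 0, Quat 0 0 1 0, Quat 0 0 0 1] ! n" for n
    fix x y
    show "B x y =
      qRe x *\<^sub>R (qRe y *\<^sub>R B (e 0) (e 0) + qI y *\<^sub>R B (e 0) (e 1) + qJ y *\<^sub>R B (e 0) (e 2) + qK y *\<^sub>R B (e 0) (e 3)) +
      qI x *\<^sub>R (qRe y *\<^sub>R B (e 1) (e 0) + qI y *\<^sub>R B (e 1) (e 1) + qJ y *\<^sub>R B (e 1) (e 2) + qK y *\<^sub>R B (e 1) (e 3)) +
      qJ x *\<^sub>R (qRe y *\<^sub>R B (e 2) (e 0) + qI y *\<^sub>R B (e 2) (e 1) + qJ y *\<^sub>R B (e 2) (e 2) + qK y *\<^sub>R B (e 2) (e 3)) +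
      qK x *\<^sub>R (qRe y *\<^sub>R B (e 3) (e 0) + qI y *\<^sub>R B (e 3) (e 1) + qJ y *\<^sub>R B (e 3) (e 2) + qK y *\<^sub>R B (e 3) (e 3))"
      unfolding B_left[of x y] B_right[of 1 y] B_right[of "Quat 0 1 0 0" y]
        B_right[of "Quat 0 0 1 0" y] B_right[of "Quat 0 0 0 1" y]
      by (simp add: e_def numeral_2_eq_2 numeral_3_eq_3)
  qed
  have average: "qaverage w = (\<Sum>e\<in>Basis. B e (qcnj e))"
    by (simp add: qaverage_def B_def)
  have "L q (qaverage w) = (\<Sum>e\<in>Basis. B (q * e) (qcnj e))"
    by (simp add: average B_def blinfun.sum_right L_mult)
  also have "\<dots> = (\<Sum>e\<in>Basis. B e (qcnj e * q))"
    unfolding M Basis_quat_def by (simp add: algebra_simps)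
  also have "\<dots> = qaverage w *\<^sub>Q q"
    by (simp add: average B_def L_scaleQ[symmetric] scaleQ_scaleQ
        linear_sum[OF bounded_linear.linear[OF bounded_linear_scaleQ_left]])
  finally show "L q (qaverage w) = qaverage w *\<^sub>Q q" .
qed

text \<open>Averaging w itself may give 0, as when all its coordinates are imaginary. A right factor
  p first rotates one nonzero coordinate to a positive real number, which the average multiplies by
  4.\<close>

lemma qaverage_nonzero:
  assumes "w \<noteq> 0"
  obtains p where "qaverage (w *\<^sub>Q p) \<noteq> 0"
proof -
  have "\<exists>z\<in>N. qinner z w \<noteq> 0"
  proof (rule ccontr)
    assume "\<not> ?thesis"
    then have "((\<lambda>z. z *\<^sub>Q 1 *\<^sub>Q qinner z w) has_sum 0) N"
      by (intro has_sum_0) auto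
    then show False
      using N(2)[of 1 w] has_sum_unique \<open>w \<noteq> 0\<close> by (fastforce simp: L_one)
  qed
  then obtain z where z: "z \<in> N" "qinner z w \<noteq> 0" by blast
  \<comment> \<open>With this factor the coordinate of v at z is |<z, w>|^2.\<close>
  define v where "v = w *\<^sub>Q qcnj (qinner z w)"
  have "inner z (L e (v *\<^sub>Q qcnj e)) = inner z v" if "e \<in> Basis" for e
  proof -
    have "inner z (L e (v *\<^sub>Q qcnj e)) = inner (L (qcnj e) z) (v *\<^sub>Q qcnj e)"
      using L_adjoint[of "qcnj e" z] by simp
    also have "\<dots> = inner z (v *\<^sub>Q (qcnj e * e))"
      by (simp add: L_basis[OF z(1)] inner_scaleQ_left scaleQ_scaleQ)
    also have "qcnj e * e = 1"
      using that by (auto simp: Basis_quat_def quat_eq_iff)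
    finally show ?thesis by (simp add: scaleQ_one)
  qed
  then have "inner z (qaverage v) = real (DIM(quat)) * inner z v"
    by (simp add: qaverage_def inner_sum_right)
  also have "inner z v = (norm (qinner z w))\<^sup>2"
    by (simp add: qRe_qinner[symmetric] v_def qinner_scaleQ_right mult_qcnj_self power2_norm_eq_inner)
  finally have "inner z (qaverage v) \<noteq> 0"
    using z(2) by simp
  then have "qaverage v \<noteq> 0" by auto
  then show thesis
    unfolding v_def by (rule that)
qed

end

context intertwining_pvm
begin

text \<open>Testing b itself against the cyclic subspace of a is enough for orthogonality of the two
  cyclic subspaces: an operator acting on b can be moved to the other side by its adjoint.\<close>

definition cyclic_family :: "'h set \<Rightarrow> bool"
  where "cyclic_family A \<longleftrightarrow> (\<forall>a\<in>A. a \<noteq> 0 \<and> intertwines a) \<and>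
    (\<forall>a\<in>A. \<forall>b\<in>A. a \<noteq> b \<longrightarrow> (\<forall>\<phi>. test_fun \<phi> \<longrightarrow> inner b (\<Phi> \<phi> a) = 0))"

text \<open>Since \<open>L q\<close> is the calculus of the constant q, it multiplies \<phi> on the
  right or on the left according to its place in the composition.\<close>

lemma \<Phi>_L:
  assumes "test_fun \<phi>"
  shows "\<Phi> \<phi> (L q u) = \<Phi> (\<lambda>x. \<phi> x * q) u" "L q (\<Phi> \<phi> u) = \<Phi> (\<lambda>x. q * \<phi> x) u"
  using \<Phi>_mult[OF assms test_fun_const, of q u] \<Phi>_mult[OF test_fun_const assms, of q u]
  by (simp_all add: \<Phi>_const)

text \<open>Moving \<open>L e\<close> and the right scalars from w to the other side keeps that side
  in the cyclic subspace of a: the left factor joins the test function, and a right factor does so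
  too because it can be applied to a as a left multiplication.\<close>

lemma qaverage_orthogonal:
  assumes a: "intertwines a" and orth: "\<And>\<phi>. test_fun \<phi> \<Longrightarrow> inner (\<Phi> \<phi> a) w = 0" and \<phi>: "test_fun \<phi>"
  shows "inner (\<Phi> \<phi> a) (qaverage (w *\<^sub>Q p)) = 0"
  unfolding qaverage_def inner_sum_right
proof (rule sum.neutral, rule ballI)
  fix e :: quat
  define r where "r = p * qcnj e"
  have tf: "test_fun (\<lambda>x. qcnj e * \<phi> x)" "test_fun (\<lambda>x. qcnj e * \<phi> x * qcnj r)"
    by (auto intro!: test_fun_mult \<phi>)
  have "inner (\<Phi> \<phi> a) (L e (w *\<^sub>Q p *\<^sub>Q qcnj e)) = inner (L (qcnj e) (\<Phi> \<phi> a)) (w *\<^sub>Q r)"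
    using L_adjoint[of "qcnj e" "\<Phi> \<phi> a"] by (simp add: r_def scaleQ_scaleQ)
  also have "\<dots> = inner (\<Phi> (\<lambda>x. qcnj e * \<phi> x) a *\<^sub>Q qcnj r) w"
    by (simp add: \<Phi>_L[OF \<phi>] inner_scaleQ_left)
  also have "\<Phi> (\<lambda>x. qcnj e * \<phi> x) a *\<^sub>Q qcnj r = \<Phi> (\<lambda>x. qcnj e * \<phi> x) (L (qcnj r) a)"
    using a by (simp add: \<Phi>_scaleQ[OF tf(1)] intertwines_def)
  also have "\<dots> = \<Phi> (\<lambda>x. qcnj e * \<phi> x * qcnj r) a"
    by (rule \<Phi>_L[OF tf(1)])
  finally show "inner (\<Phi> \<phi> a) (L e (w *\<^sub>Q p *\<^sub>Q qcnj e)) = 0"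
    using orth[OF tf(2)] by simp
qed

lemma total_cyclic_family:
  obtains A where "cyclic_family A"
    "\<And>w. (\<And>a \<phi>. a \<in> A \<Longrightarrow> test_fun \<phi> \<Longrightarrow> inner (\<Phi> \<phi> a) w = 0) \<Longrightarrow> w = 0"
proof -
  have "\<Union>C \<in> Collect cyclic_family" if "subset.chain (Collect cyclic_family) C" for C
  proof -
    have C: "C \<subseteq> Collect cyclic_family" "\<And>A B. A \<in> C \<Longrightarrow> B \<in> C \<Longrightarrow> A \<subseteq> B \<or> B \<subseteq> A"
      using that by (auto simp: subset_chain_def)
    have "inner b (\<Phi> \<phi> a) = 0"
      if ab: "A \<in> C" "a \<in> A" "B \<in> C" "b \<in> B" "a \<noteq> b" "test_fun \<phi>" for a b A B \<phi>
    proof -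
      obtain D where "D \<in> C" "a \<in> D" "b \<in> D"
        using C(2)[OF ab(1) ab(3)] ab by blast
      then show ?thesis
        using C(1) ab by (auto simp: cyclic_family_def)
    qed
    then show ?thesis
      using C(1) by (fastforce simp: cyclic_family_def)
  qed
  from subset_Zorn'[OF this] obtain A where A: "cyclic_family A"
    and max: "\<And>B. cyclic_family B \<Longrightarrow> A \<subseteq> B \<Longrightarrow> B = A"
    by auto
  have "w = 0" if w: "\<And>a \<phi>. a \<in> A \<Longrightarrow> test_fun \<phi> \<Longrightarrow> inner (\<Phi> \<phi> a) w = 0" for w
  proof (rule ccontr)
    assume "w \<noteq> 0"
    then obtain p where p: "qaverage (w *\<^sub>Q p) \<noteq> 0" by (rule qaverage_nonzero)
    define v where "v = qaverage (w *\<^sub>Q p)"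
    have v: "intertwines v" "v \<noteq> 0"
      using p by (auto simp: v_def qaverage_intertwines)
    have orth: "inner (\<Phi> \<phi> a) v = 0" if "a \<in> A" "test_fun \<phi>" for a \<phi>
      unfolding v_def using A that w by (intro qaverage_orthogonal) (auto simp: cyclic_family_def)
    \<comment> \<open>Enlarging the family requires orthogonality with v in either role; the adjoint
      with the conjugate test function yields the second from the first.\<close>
    then have orth': "inner a (\<Phi> \<phi> v) = 0" if "a \<in> A" "test_fun \<phi>" for a \<phi>
      using \<Phi>_adjoint[OF test_fun_qcnj, of \<phi> a v] that orth[OF _ test_fun_qcnj] by simp
    have "cyclic_family (insert v A)"
      using A v orth orth' by (auto simp: cyclic_family_def inner_commute[of v])
    then have "v \<in> A" using max[of "insert v A"] by blast
    \<comment> \<open>The constant 1 tests v against itself.\<close>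
    then have "inner (\<Phi> (\<lambda>_. 1) v) v = 0" by (intro orth) auto
    then show False using v by (simp add: \<Phi>_const L_one)
  qed
  with A show thesis by (rule that)
qed

end

section \<open>Densities with respect to a total cyclic family\<close>

lemma L2_integrable_inner:
  fixes f g :: "'a \<Rightarrow> 'b::{real_inner, banach, second_countable_topology}"
  assumes [measurable]: "f \<in> borel_measurable M" "g \<in> borel_measurable M"
    and "integrable M (\<lambda>x. (norm (f x))\<^sup>2)" "integrable M (\<lambda>x. (norm (g x))\<^sup>2)"
  shows "integrable M (\<lambda>x. inner (f x) (g x))"
proof (rule Bochner_Integration.integrable_bound[of _ "\<lambda>x. (norm (f x))\<^sup>2 + (norm (g x))\<^sup>2"])
  have "\<bar>inner (f x) (g x)\<bar> \<le> (norm (f x))\<^sup>2 + (norm (g x))\<^sup>2" for x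
  proof -
    have "\<bar>inner (f x) (g x)\<bar> \<le> norm (f x) * norm (g x)"
      by (rule Cauchy_Schwarz_ineq2)
    also have "\<dots> \<le> (norm (f x))\<^sup>2 + (norm (g x))\<^sup>2"
    proof -
      have "2 * (norm (f x) * norm (g x)) \<le> (norm (f x))\<^sup>2 + (norm (g x))\<^sup>2"
        using zero_le_power2[of "norm (f x) - norm (g x)"] by (simp add: power2_eq_square algebra_simps)
      moreover have "0 \<le> norm (f x) * norm (g x)" by simp
      ultimately show ?thesis by linarith
    qed
    finally show ?thesis .
  qed
  then show "AE x in M. norm (inner (f x) (g x)) \<le> norm ((norm (f x))\<^sup>2 + (norm (g x))\<^sup>2)"
    by auto
qed (use assms in auto)

lemma L2_Cauchy_Schwarz:
  fixes f g :: "'a \<Rightarrow> 'b::{real_inner, banach, second_countable_topology}"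
  assumes meas: "f \<in> borel_measurable M" "g \<in> borel_measurable M"
    and int: "integrable M (\<lambda>x. (norm (f x))\<^sup>2)" "integrable M (\<lambda>x. (norm (g x))\<^sup>2)"
  shows "(\<integral>x. inner (f x) (g x) \<partial>M)\<^sup>2 \<le> (\<integral>x. (norm (f x))\<^sup>2 \<partial>M) * (\<integral>x. (norm (g x))\<^sup>2 \<partial>M)"
proof -
  define a b c where "a = (\<integral>x. (norm (f x))\<^sup>2 \<partial>M)" and "b = (\<integral>x. inner (f x) (g x) \<partial>M)"
    and "c = (\<integral>x. (norm (g x))\<^sup>2 \<partial>M)"
  have quadratic: "0 \<le> a - 2 * t * b + t\<^sup>2 * c" for t
  proof -
    have "0 \<le> (\<integral>x. (norm (f x - t *\<^sub>R g x))\<^sup>2 \<partial>M)" by simp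
    also have "\<dots> = (\<integral>x. (norm (f x))\<^sup>2 - 2 * t * inner (f x) (g x) + t\<^sup>2 * (norm (g x))\<^sup>2 \<partial>M)"
    proof (rule Bochner_Integration.integral_cong)
      fix x
      show "(norm (f x - t *\<^sub>R g x))\<^sup>2 = (norm (f x))\<^sup>2 - 2 * t * inner (f x) (g x) + t\<^sup>2 * (norm (g x))\<^sup>2"
        unfolding power2_norm_eq_inner by (simp add: power2_eq_square inner_commute algebra_simps)
    qed simp
    also have "\<dots> = a - 2 * t * b + t\<^sup>2 * c"
      using int L2_integrable_inner[OF meas int] by (simp add: a_def b_def c_def)
    finally show ?thesis .
  qed
  have "c \<ge> 0" by (simp add: c_def)
  have "b\<^sup>2 \<le> a * c"
  proof (cases "c = 0")
    case True
    have "b = 0"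
    proof (rule ccontr)
      assume "b \<noteq> 0"
      then show False
        \<comment> \<open>With c = 0 the quadratic is a - 2 t b, and at this t its value is
          -1.\<close>
        using quadratic[of "(a + 1) / (2 * b)"] True by simp
    qed
    then show ?thesis using True by simp
  next
    case False
    then have "c > 0" using \<open>c \<ge> 0\<close> by simp
    have "0 \<le> (a - 2 * (b / c) * b + (b / c)\<^sup>2 * c) * c"
      using quadratic[of "b / c"] \<open>c \<ge> 0\<close> by (intro mult_nonneg_nonneg)
    also have "\<dots> = a * c - b\<^sup>2"
      using False by (simp add: field_simps power2_eq_square)
    finally show ?thesis by simp
  qed
  then show ?thesis by (simp add: a_def b_def c_def)
qed

lemma L2_tendsto_inner:
  fixes f g :: "'a \<Rightarrow> 'b::{real_inner, banach, second_countable_topology}"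
  assumes meas: "g \<in> borel_measurable M" "\<And>n. s n \<in> borel_measurable M" "f \<in> borel_measurable M"
    and int: "integrable M (\<lambda>x. (norm (g x))\<^sup>2)" "\<And>n. integrable M (\<lambda>x. (norm (s n x))\<^sup>2)"
      "integrable M (\<lambda>x. (norm (f x))\<^sup>2)"
    and lim: "(\<lambda>n. \<integral>x. (norm (s n x - f x))\<^sup>2 \<partial>M) \<longlonglongrightarrow> 0"
  shows "(\<lambda>n. \<integral>x. inner (g x) (s n x) \<partial>M) \<longlonglongrightarrow> (\<integral>x. inner (g x) (f x) \<partial>M)"
proof -
  define d where "d n = (\<integral>x. inner (g x) (s n x - f x) \<partial>M)" for n
  have intd: "integrable M (\<lambda>x. (norm (s n x - f x))\<^sup>2)" for n
    by (intro integrable_norm_squared_diff meas int)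
  have d: "d n = (\<integral>x. inner (g x) (s n x) \<partial>M) - (\<integral>x. inner (g x) (f x) \<partial>M)" for n
    unfolding d_def inner_diff_right
    by (intro Bochner_Integration.integral_diff L2_integrable_inner meas int)
  have "(\<lambda>n. (d n)\<^sup>2) \<longlonglongrightarrow> 0"
  proof (rule tendsto_sandwich[OF _ _ tendsto_const])
    have "(d n)\<^sup>2 \<le> (\<integral>x. (norm (g x))\<^sup>2 \<partial>M) * (\<integral>x. (norm (s n x - f x))\<^sup>2 \<partial>M)" for n
      unfolding d_def by (intro L2_Cauchy_Schwarz meas int intd borel_measurable_diff)
    then show "\<forall>\<^sub>F n in sequentially. (d n)\<^sup>2 \<le> (\<integral>x. (norm (g x))\<^sup>2 \<partial>M) * (\<integral>x. (norm (s n x - f x))\<^sup>2 \<partial>M)"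
      by simp
    show "(\<lambda>n. (\<integral>x. (norm (g x))\<^sup>2 \<partial>M) * (\<integral>x. (norm (s n x - f x))\<^sup>2 \<partial>M)) \<longlonglongrightarrow> 0"
      using tendsto_mult_left[OF lim] by simp
  qed simp
  then have "(\<lambda>n. sqrt ((d n)\<^sup>2)) \<longlonglongrightarrow> sqrt 0"
    by (rule tendsto_real_sqrt)
  then have "d \<longlonglongrightarrow> 0"
    by (simp add: tendsto_rabs_zero_iff)
  then show ?thesis
    unfolding d[abs_def] by (simp add: LIM_zero_iff)
qed

text \<open>Large values are replaced by 0 instead of being cut down to length n: this gives
  <truncation, f> = |truncation|^2 pointwise, which \<open>Bessel_inequality\<close> uses.\<close>

definition truncation :: "nat \<Rightarrow> ('a \<Rightarrow> 'b::real_normed_vector) \<Rightarrow> 'a \<Rightarrow> 'b"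
  where "truncation n f x = (if norm (f x) \<le> real n then f x else 0)"

lemma truncation_measurable [measurable]:
  fixes f :: "'a \<Rightarrow> 'b::{banach, second_countable_topology}"
  assumes [measurable]: "f \<in> borel_measurable M"
  shows "truncation n f \<in> borel_measurable M"
  unfolding truncation_def[abs_def] by measurable

lemma norm_truncation_le: "norm (truncation n f x) \<le> real n" "norm (truncation n f x) \<le> norm (f x)"
  by (auto simp: truncation_def)

lemma truncation_eventually: "eventually (\<lambda>n. truncation n f x = f x) sequentially"
  using eventually_ge_at_top[of "nat \<lceil>norm (f x)\<rceil>"]
  by eventually_elim (auto simp: truncation_def le_nat_iff ceiling_le_iff)

lemma truncation_L2:
  fixes f :: "'a \<Rightarrow> 'b::{banach, second_countable_topology}"
  assumes [measurable]: "f \<in> borel_measurable M" and int: "integrable M (\<lambda>x. (norm (f x))\<^sup>2)"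
  shows "integrable M (\<lambda>x. (norm (truncation n f x))\<^sup>2)"
    and "(\<lambda>n. \<integral>x. (norm (truncation n f x))\<^sup>2 \<partial>M) \<longlonglongrightarrow> (\<integral>x. (norm (f x))\<^sup>2 \<partial>M)"
    and "(\<lambda>n. \<integral>x. (norm (truncation n f x - f x))\<^sup>2 \<partial>M) \<longlonglongrightarrow> 0"
proof -
  have le: "(norm (truncation n f x))\<^sup>2 \<le> (norm (f x))\<^sup>2" "(norm (truncation n f x - f x))\<^sup>2 \<le> (norm (f x))\<^sup>2" for n x
    by (auto simp: truncation_def)
  show "integrable M (\<lambda>x. (norm (truncation n f x))\<^sup>2)"
    by (rule Bochner_Integration.integrable_bound[OF int]) (use le in auto)
  show "(\<lambda>n. \<integral>x. (norm (truncation n f x))\<^sup>2 \<partial>M) \<longlonglongrightarrow> (\<integral>x. (norm (f x))\<^sup>2 \<partial>M)"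
  proof (rule integral_dominated_convergence[OF _ _ int])
    have "(\<lambda>n. (norm (truncation n f x))\<^sup>2) \<longlonglongrightarrow> (norm (f x))\<^sup>2" for x
      by (rule tendsto_eventually) (use truncation_eventually[of f x] in eventually_elim, simp)
    then show "AE x in M. (\<lambda>n. (norm (truncation n f x))\<^sup>2) \<longlonglongrightarrow> (norm (f x))\<^sup>2" by simp
  qed (use le in auto)
  have "(\<lambda>n. \<integral>x. (norm (truncation n f x - f x))\<^sup>2 \<partial>M) \<longlonglongrightarrow> (\<integral>x. 0 \<partial>M)"
  proof (rule integral_dominated_convergence[OF _ _ int])
    have "(\<lambda>n. (norm (truncation n f x - f x))\<^sup>2) \<longlonglongrightarrow> 0" for x
      by (rule tendsto_eventually) (use truncation_eventually[of f x] in eventually_elim, simp)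
    then show "AE x in M. (\<lambda>n. (norm (truncation n f x - f x))\<^sup>2) \<longlonglongrightarrow> 0" by simp
  qed (use le in auto)
  then show "(\<lambda>n. \<integral>x. (norm (truncation n f x - f x))\<^sup>2 \<partial>M) \<longlonglongrightarrow> 0" by simp
qed

lemma L2_functionsD:
  assumes "f \<in> L2_functions M"
  shows "f \<in> borel_measurable M" "integrable M (\<lambda>x. (norm (f x))\<^sup>2)"
  using assms by (simp_all add: L2_functions_def)

lemma L2_functions_add: "f \<in> L2_functions M \<Longrightarrow> g \<in> L2_functions M \<Longrightarrow> (\<lambda>x. f x + g x) \<in> L2_functions M"
  by (auto simp: L2_functions_def intro: integrable_norm_squared_add)

lemma L2_functions_diff: "f \<in> L2_functions M \<Longrightarrow> g \<in> L2_functions M \<Longrightarrow> (\<lambda>x. f x - g x) \<in> L2_functions M"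
  by (auto simp: L2_functions_def intro: integrable_norm_squared_diff)

lemma L2_functions_bounded_mult_left:
  assumes f: "f \<in> L2_functions M" and [measurable]: "\<phi> \<in> borel_measurable M"
    and bdd: "bounded (\<phi> ` space M)"
  shows "(\<lambda>x. \<phi> x * f x) \<in> L2_functions M"
proof -
  note [measurable] = L2_functionsD(1)[OF f]
  obtain C where C: "\<And>x. x \<in> space M \<Longrightarrow> norm (\<phi> x) \<le> C"
    using bdd by (auto simp: bounded_iff)
  have "integrable M (\<lambda>x. (norm (\<phi> x * f x))\<^sup>2)"
  proof (rule Bochner_Integration.integrable_bound[of _ "\<lambda>x. C\<^sup>2 * (norm (f x))\<^sup>2"])
    show "AE x in M. norm ((norm (\<phi> x * f x))\<^sup>2) \<le> norm (C\<^sup>2 * (norm (f x))\<^sup>2)"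
      using C by (intro AE_I2) (auto simp: norm_mult power_mult_distrib intro!: mult_right_mono power_mono)
  qed (use L2_functionsD(2)[OF f] in auto)
  then show ?thesis by (simp add: L2_functions_def)
qed

lemma L2_functions_mult_right:
  assumes f: "f \<in> L2_functions M"
  shows "(\<lambda>x. f x * q) \<in> L2_functions M"
  using L2_functionsD[OF f] by (simp add: L2_functions_def norm_mult power_mult_distrib)

section \<open>Analysis and synthesis of vectors by densities\<close>

locale cyclic_decomposition = intertwining_pvm +
  fixes A
  assumes cyclic: "cyclic_family A"
    and total: "\<And>w. (\<And>a \<phi>. a \<in> A \<Longrightarrow> test_fun \<phi> \<Longrightarrow> inner (\<Phi> \<phi> a) w = 0) \<Longrightarrow> w = 0"
begin

lemma A_intertwines: "a \<in> A \<Longrightarrow> L q a = a *\<^sub>Q q"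
  using cyclic by (auto simp: cyclic_family_def intertwines_def)

lemma test_fun_L2: "test_fun \<phi> \<Longrightarrow> \<phi> \<in> L2_functions (\<nu> a)"
proof -
  assume \<phi>: "test_fun \<phi>"
  interpret finite_measure "\<nu> a" by (rule finite_measure_\<nu>)
  have "(\<lambda>x. 1) \<in> L2_functions (\<nu> a)"
    by (simp add: L2_functions_def)
  then show ?thesis
    using L2_functions_bounded_mult_left[of "\<lambda>x. 1" "\<nu> a" \<phi>] \<phi>
    by (simp add: test_fun_def measurable_cong_sets[OF sets_\<nu> refl])
qed

lemma test_fun_truncation:
  assumes "f \<in> L2_functions (\<nu> a)"
  shows "test_fun (truncation n f)"
  using L2_functionsD(1)[OF assms] norm_truncation_le(1)[of n f]
  by (auto simp: test_fun_def measurable_cong_sets[OF sets_\<nu> refl] bounded_iff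
      intro!: truncation_measurable)

lemma norm_\<Phi>:
  "a \<in> A \<Longrightarrow> test_fun \<phi> \<Longrightarrow> (norm (\<Phi> \<phi> a))\<^sup>2 = (\<integral>x. (norm (\<phi> x))\<^sup>2 \<partial>\<nu> a)"
  using inner_\<Phi>_\<Phi>[of \<phi> \<phi> a] by (simp add: power2_norm_eq_inner A_intertwines)

lemma \<Phi>_orthogonal:
  assumes "a \<in> A" "b \<in> A" "a \<noteq> b" "test_fun \<phi>" "test_fun \<psi>"
  shows "inner (\<Phi> \<phi> a) (\<Phi> \<psi> b) = 0"
proof -
  have "inner (\<Phi> \<phi> a) (\<Phi> \<psi> b) = inner a (\<Phi> (\<lambda>x. qcnj (\<phi> x) * \<psi> x) b)"
    using assms by (simp add: \<Phi>_adjoint \<Phi>_mult test_fun_qcnj)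
  then show ?thesis
    using cyclic assms test_fun_mult[OF test_fun_qcnj, of \<phi> \<psi>] by (auto simp: cyclic_family_def)
qed

lemma test_fun_diff: "test_fun \<phi> \<Longrightarrow> test_fun \<psi> \<Longrightarrow> test_fun (\<lambda>x. \<phi> x - \<psi> x)"
  using test_fun_add[OF _ test_fun_mult[OF test_fun_const], of \<phi> \<psi> "- 1"] by simp

lemma \<Phi>_diff: "test_fun \<phi> \<Longrightarrow> test_fun \<psi> \<Longrightarrow> \<Phi> (\<lambda>x. \<phi> x - \<psi> x) = \<Phi> \<phi> - \<Phi> \<psi>"
  using \<Phi>_add[OF test_fun_diff, of \<phi> \<psi> \<psi>] by (simp add: algebra_simps)

text \<open>
  \<open>represents f u\<close> expresses that \<open>f a\<close> is the density of the component of \<open>u\<close> in the cyclic subspace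
  generated by \<open>a\<close>. Testing against the dense vectors \<open>\<Phi> \<phi> a\<close> makes linearity, the intertwining
  property and the uniqueness of \<open>u\<close> immediate.
\<close>

definition represents :: "('a \<Rightarrow> quat \<Rightarrow> quat) \<Rightarrow> 'a \<Rightarrow> bool"
  where "represents f u \<longleftrightarrow> (\<forall>a\<in>A. f a \<in> L2_functions (\<nu> a)) \<and>
    (\<forall>a\<in>A. \<forall>\<phi>. test_fun \<phi> \<longrightarrow> inner (\<Phi> \<phi> a) u = (\<integral>x. inner (\<phi> x) (f a x) \<partial>\<nu> a))"

lemma representsD:
  assumes "represents f u" "a \<in> A"
  shows "f a \<in> L2_functions (\<nu> a)"
    and "test_fun \<phi> \<Longrightarrow> inner (\<Phi> \<phi> a) u = (\<integral>x. inner (\<phi> x) (f a x) \<partial>\<nu> a)"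
  using assms by (auto simp: represents_def)

lemma integrable_inner:
  "f \<in> L2_functions (\<nu> a) \<Longrightarrow> test_fun \<phi> \<Longrightarrow> integrable (\<nu> a) (\<lambda>x. inner (\<phi> x) (f x))"
  using L2_functionsD test_fun_L2 by (intro L2_integrable_inner) blast+

lemma represents_add:
  assumes "represents f u" "represents g v"
  shows "represents (\<lambda>a x. f a x + g a x) (u + v)"
  using assms by (auto simp: represents_def inner_add_right integrable_inner intro: L2_functions_add)

lemma represents_diff:
  assumes "represents f u" "represents g v"
  shows "represents (\<lambda>a x. f a x - g a x) (u - v)"
  using assms by (auto simp: represents_def inner_diff_right integrable_inner intro: L2_functions_diff)

text \<open>The scalar q on u becomes its conjugate on \<open>\<Phi> \<phi> a\<close>, is applied to
  a as a left multiplication and so joins the test function on the right; pointwise it returns to f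
  as a right factor.\<close>

lemma represents_scaleQ:
  assumes "represents f u"
  shows "represents (\<lambda>a x. f a x * q) (u *\<^sub>Q q)"
  unfolding represents_def
proof (intro conjI ballI allI impI)
  fix a assume a: "a \<in> A"
  show "(\<lambda>x. f a x * q) \<in> L2_functions (\<nu> a)"
    using representsD(1)[OF assms a] by (rule L2_functions_mult_right)
  fix \<phi> assume \<phi>: "test_fun \<phi>"
  have "inner (\<Phi> \<phi> a) (u *\<^sub>Q q) = inner (\<Phi> \<phi> (L (qcnj q) a)) u"
    by (simp add: A_intertwines[OF a] \<Phi>_scaleQ[OF \<phi>] inner_scaleQ_left)
  also have "\<dots> = (\<integral>x. inner (\<phi> x * qcnj q) (f a x) \<partial>\<nu> a)"
    using representsD(2)[OF assms a test_fun_mult[OF \<phi> test_fun_const]] by (simp add: \<Phi>_L[OF \<phi>])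
  also have "(\<lambda>x. inner (\<phi> x * qcnj q) (f a x)) = (\<lambda>x. inner (\<phi> x) (f a x * q))"
    by (simp add: inner_quat_def algebra_simps)
  finally show "inner (\<Phi> \<phi> a) (u *\<^sub>Q q) = (\<integral>x. inner (\<phi> x) (f a x * q) \<partial>\<nu> a)" .
qed

text \<open>The adjoint moves \<psi> into the test function as a conjugate left factor, and the
  pointwise inner product moves it back to f. The multiplication formula of the theorem rests on
  this.\<close>

lemma represents_\<Phi>:
  assumes "represents f u" and \<psi>: "test_fun \<psi>"
  shows "represents (\<lambda>a x. \<psi> x * f a x) (\<Phi> \<psi> u)"
  unfolding represents_def
proof (intro conjI ballI allI impI)
  fix a assume a: "a \<in> A"
  show "(\<lambda>x. \<psi> x * f a x) \<in> L2_functions (\<nu> a)"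
    using representsD(1)[OF assms(1) a] \<psi>
    by (intro L2_functions_bounded_mult_left) (auto simp: test_fun_def measurable_cong_sets[OF sets_\<nu> refl])
  fix \<phi> assume \<phi>: "test_fun \<phi>"
  have "inner (\<Phi> \<phi> a) (\<Phi> \<psi> u) = inner (\<Phi> (\<lambda>x. qcnj (\<psi> x) * \<phi> x) a) u"
    using \<Phi>_adjoint[OF test_fun_qcnj[OF \<psi>], of "\<Phi> \<phi> a" u] by (simp add: \<Phi>_mult test_fun_qcnj \<phi> \<psi>)
  also have "\<dots> = (\<integral>x. inner (qcnj (\<psi> x) * \<phi> x) (f a x) \<partial>\<nu> a)"
    by (intro representsD(2)[OF assms(1) a] test_fun_mult test_fun_qcnj \<phi> \<psi>)
  also have "(\<lambda>x. inner (qcnj (\<psi> x) * \<phi> x) (f a x)) = (\<lambda>x. inner (\<phi> x) (\<psi> x * f a x))"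
    by (simp add: inner_quat_def algebra_simps)
  finally show "inner (\<Phi> \<phi> a) (\<Phi> \<psi> u) = (\<integral>x. inner (\<phi> x) (\<psi> x * f a x) \<partial>\<nu> a)" .
qed

lemma represents_unique:
  assumes "represents f u" "represents f v"
  shows "u = v"
proof -
  have "inner (\<Phi> \<phi> a) (u - v) = 0" if "a \<in> A" "test_fun \<phi>" for a \<phi>
    using representsD(2)[OF assms(1) that] representsD(2)[OF assms(2) that]
    by (simp add: inner_diff_right)
  then have "u - v = 0" by (rule total)
  then show ?thesis by simp
qed

lemma represents_cong:
  assumes "represents f u" "\<And>a. a \<in> A \<Longrightarrow> g a \<in> L2_functions (\<nu> a)"
    and "\<And>a. a \<in> A \<Longrightarrow> AE x in \<nu> a. f a x = g a x"
  shows "represents g u"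
  unfolding represents_def
proof (intro conjI ballI allI impI)
  fix a \<phi> assume a: "a \<in> A" and \<phi>: "test_fun \<phi>"
  have "(\<integral>x. inner (\<phi> x) (f a x) \<partial>\<nu> a) = (\<integral>x. inner (\<phi> x) (g a x) \<partial>\<nu> a)"
    using integrable_inner[OF representsD(1)[OF assms(1) a] \<phi>] integrable_inner[OF assms(2)[OF a] \<phi>]
      assms(3)[OF a]
    by (intro integral_cong_AE) auto
  then show "inner (\<Phi> \<phi> a) u = (\<integral>x. inner (\<phi> x) (g a x) \<partial>\<nu> a)"
    using representsD(2)[OF assms(1) a \<phi>] by simp
qed (fact assms(2))

text \<open>The truncated densities are test functions and define a vector w with <w, u> = |w|^2, so
  |w| is at most |u| by Cauchy-Schwarz; then the truncation is removed in the limit.\<close>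

lemma Bessel_inequality:
  assumes f: "represents f u" and F: "finite F" "F \<subseteq> A"
  shows "(\<Sum>a\<in>F. \<integral>x. (norm (f a x))\<^sup>2 \<partial>\<nu> a) \<le> (norm u)\<^sup>2"
proof (rule LIMSEQ_le_const2)
  define t where "t n a = truncation n (f a)" for n a
  have L2: "f a \<in> L2_functions (\<nu> a)" if "a \<in> F" for a
    using representsD(1)[OF f] F that by auto
  have t: "test_fun (t n a)" if "a \<in> F" for n a
    unfolding t_def using L2[OF that] by (rule test_fun_truncation)
  show "(\<lambda>n. \<Sum>a\<in>F. \<integral>x. (norm (t n a x))\<^sup>2 \<partial>\<nu> a) \<longlonglongrightarrow> (\<Sum>a\<in>F. \<integral>x. (norm (f a x))\<^sup>2 \<partial>\<nu> a)"
    unfolding t_def by (intro tendsto_sum truncation_L2 L2_functionsD L2)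
  have "(\<Sum>a\<in>F. \<integral>x. (norm (t n a x))\<^sup>2 \<partial>\<nu> a) \<le> (norm u)\<^sup>2" for n
  proof -
    define w where "w = (\<Sum>a\<in>F. \<Phi> (t n a) a)"
    have "(norm w)\<^sup>2 = (\<Sum>a\<in>F. (norm (\<Phi> (t n a) a))\<^sup>2)"
      unfolding w_def using F t
      by (intro norm_sum_Pythagorean) (auto simp: pairwise_def orthogonal_def intro!: \<Phi>_orthogonal)
    also have "\<dots> = (\<Sum>a\<in>F. \<integral>x. (norm (t n a x))\<^sup>2 \<partial>\<nu> a)"
      using F t by (intro sum.cong norm_\<Phi>) auto
    finally have w: "(norm w)\<^sup>2 = (\<Sum>a\<in>F. \<integral>x. (norm (t n a x))\<^sup>2 \<partial>\<nu> a)" .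
    have "inner w u = (\<Sum>a\<in>F. inner (\<Phi> (t n a) a) u)"
      by (simp add: w_def inner_sum_left)
    also have "\<dots> = (\<Sum>a\<in>F. \<integral>x. inner (t n a x) (f a x) \<partial>\<nu> a)"
      using F t by (intro sum.cong representsD(2)[OF f]) auto
    also have "(\<lambda>a x. inner (t n a x) (f a x)) = (\<lambda>a x. (norm (t n a x))\<^sup>2)"
      by (auto simp: fun_eq_iff t_def truncation_def power2_norm_eq_inner)
    finally have "inner w u = (norm w)\<^sup>2"
      by (simp add: w)
    then have "norm w * norm w \<le> norm w * norm u"
      using norm_cauchy_schwarz[of w u] by (simp add: power2_eq_square)
    then have "norm w \<le> norm u"
      by (cases "w = 0") auto
    then show ?thesis
      unfolding w[symmetric] by (intro power_mono) auto
  qed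
  then show "\<exists>K. \<forall>n\<ge>K. (\<Sum>a\<in>F. \<integral>x. (norm (t n a x))\<^sup>2 \<partial>\<nu> a) \<le> (norm u)\<^sup>2"
    by blast
qed

text \<open>The difference of two densities of u represents 0, and the Bessel inequality makes its
  L2 norm vanish.\<close>

lemma represents_AE_unique:
  assumes "represents f u" "represents g u" "a \<in> A"
  shows "AE x in \<nu> a. f a x = g a x"
proof -
  have rep: "represents (\<lambda>a x. f a x - g a x) 0"
    using represents_diff[OF assms(1,2)] by simp
  have "(\<integral>x. (norm (f a x - g a x))\<^sup>2 \<partial>\<nu> a) \<le> 0"
    using Bessel_inequality[OF rep, of "{a}"] assms(3) by simp
  then have "(\<integral>x. (norm (f a x - g a x))\<^sup>2 \<partial>\<nu> a) = 0"
    by (intro antisym) auto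
  then have "AE x in \<nu> a. (norm (f a x - g a x))\<^sup>2 = 0"
    using L2_functionsD(2)[OF representsD(1)[OF rep assms(3)]]
    by (subst (asm) integral_nonneg_eq_0_iff_AE) auto
  then show ?thesis by simp
qed

lemma orthogonal_closure:
  assumes "v \<in> closure {\<Phi> \<phi> a |\<phi>. test_fun \<phi>}" "\<And>\<phi>. test_fun \<phi> \<Longrightarrow> inner (\<Phi> \<phi> a) w = 0"
  shows "inner v w = 0"
proof -
  have "closure {\<Phi> \<phi> a |\<phi>. test_fun \<phi>} \<subseteq> {v. inner v w = 0}"
    using assms(2) by (intro closure_minimal closed_Collect_eq continuous_intros) auto
  then show ?thesis using assms(1) by blast
qed

text \<open>By the isometry the vectors of the truncations of f form a Cauchy sequence. Membership
  of the limit in the closure is recorded because it makes components for different a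
  orthogonal.\<close>

lemma cyclic_component:
  assumes a: "a \<in> A" and f: "f \<in> L2_functions (\<nu> a)"
  shows "\<exists>v. v \<in> closure {\<Phi> \<phi> a |\<phi>. test_fun \<phi>} \<and> (norm v)\<^sup>2 = (\<integral>x. (norm (f x))\<^sup>2 \<partial>\<nu> a) \<and>
    (\<forall>\<phi>. test_fun \<phi> \<longrightarrow> inner (\<Phi> \<phi> a) v = (\<integral>x. inner (\<phi> x) (f x) \<partial>\<nu> a))"
proof -
  define t where "t n = truncation n f" for n
  \<comment> \<open>The factor 2 is that of |x - y|^2 \<le> 2 |x|^2 + 2 |y|^2, applied to the
    distances from f.\<close>
  define b where "b n = 2 * (\<integral>x. (norm (t n x - f x))\<^sup>2 \<partial>\<nu> a)" for n
  note t_L2 = truncation_L2[OF L2_functionsD[OF f], folded t_def]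
  have t: "test_fun (t n)" for n
    unfolding t_def using f by (rule test_fun_truncation)
  have fin: "integrable (\<nu> a) (\<lambda>x. (norm (t n x - f x))\<^sup>2)" for n
    using L2_functions_diff[OF test_fun_L2[OF t] f] by (rule L2_functionsD)
  have "(norm (\<Phi> (t m) a - \<Phi> (t n) a))\<^sup>2 \<le> b m + b n" for m n
  proof -
    have "(norm (\<Phi> (t m) a - \<Phi> (t n) a))\<^sup>2 = (\<integral>x. (norm (t m x - t n x))\<^sup>2 \<partial>\<nu> a)"
      using norm_\<Phi>[OF a test_fun_diff[OF t t]] by (simp add: \<Phi>_diff[OF t t] minus_blinfun.rep_eq)
    also have "\<dots> \<le> (\<integral>x. 2 * (norm (t m x - f x))\<^sup>2 + 2 * (norm (t n x - f x))\<^sup>2 \<partial>\<nu> a)"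
    proof (rule integral_mono)
      show "(norm (t m x - t n x))\<^sup>2 \<le> 2 * (norm (t m x - f x))\<^sup>2 + 2 * (norm (t n x - f x))\<^sup>2" for x
        using norm_diff_squared_le[of "t m x - f x" "t n x - f x"] by simp
      show "integrable (\<nu> a) (\<lambda>x. (norm (t m x - t n x))\<^sup>2)"
        using test_fun_L2[OF test_fun_diff[OF t t]] by (rule L2_functionsD)
    qed (use fin in simp)
    also have "\<dots> = b m + b n"
      using fin by (simp add: b_def)
    finally show ?thesis .
  qed
  moreover have "b \<longlonglongrightarrow> 0"
    unfolding b_def using tendsto_mult_left[OF t_L2(3), of 2] by simp
  ultimately have "Cauchy (\<lambda>n. \<Phi> (t n) a)"
    by (rule Cauchy_if_norm_squared_le)
  then obtain v where v: "(\<lambda>n. \<Phi> (t n) a) \<longlonglongrightarrow> v"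
    using Cauchy_convergent convergent_def by blast
  have "v \<in> closure {\<Phi> \<phi> a |\<phi>. test_fun \<phi>}"
    unfolding closure_sequential using v t by (intro exI[of _ "\<lambda>n. \<Phi> (t n) a"]) auto
  moreover have "(norm v)\<^sup>2 = (\<integral>x. (norm (f x))\<^sup>2 \<partial>\<nu> a)"
  proof (rule LIMSEQ_unique)
    show "(\<lambda>n. (norm (\<Phi> (t n) a))\<^sup>2) \<longlonglongrightarrow> (norm v)\<^sup>2"
      by (intro tendsto_intros v)
    show "(\<lambda>n. (norm (\<Phi> (t n) a))\<^sup>2) \<longlonglongrightarrow> (\<integral>x. (norm (f x))\<^sup>2 \<partial>\<nu> a)"
      using t_L2(2) by (simp add: norm_\<Phi>[OF a t])
  qed
  moreover have "inner (\<Phi> \<phi> a) v = (\<integral>x. inner (\<phi> x) (f x) \<partial>\<nu> a)" if \<phi>: "test_fun \<phi>" for \<phi>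
  proof (rule LIMSEQ_unique)
    show "(\<lambda>n. inner (\<Phi> \<phi> a) (\<Phi> (t n) a)) \<longlonglongrightarrow> inner (\<Phi> \<phi> a) v"
      by (intro tendsto_inner tendsto_const v)
    show "(\<lambda>n. inner (\<Phi> \<phi> a) (\<Phi> (t n) a)) \<longlonglongrightarrow> (\<integral>x. inner (\<phi> x) (f x) \<partial>\<nu> a)"
      unfolding inner_\<Phi>_\<Phi>[OF \<phi> t A_intertwines[OF a]]
      by (intro L2_tendsto_inner L2_functionsD test_fun_L2 \<phi> f t t_L2(3))
  qed
  ultimately show ?thesis by blast
qed

text \<open>Orthogonal components with summable squared norms can be added; pairing the sum with
  \<open>\<Phi> \<phi> a\<close> sees only the component at a. This gives surjectivity of V.\<close>

lemma represented_vector: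
  assumes f: "\<And>a. a \<in> A \<Longrightarrow> f a \<in> L2_functions (\<nu> a)"
    and sum: "(\<lambda>a. \<integral>x. (norm (f a x))\<^sup>2 \<partial>\<nu> a) summable_on A"
  obtains u where "represents f u" "((\<lambda>a. \<integral>x. (norm (f a x))\<^sup>2 \<partial>\<nu> a) has_sum (norm u)\<^sup>2) A"
proof -
  have "\<exists>v. \<forall>a\<in>A. v a \<in> closure {\<Phi> \<phi> a |\<phi>. test_fun \<phi>} \<and>
      (norm (v a))\<^sup>2 = (\<integral>x. (norm (f a x))\<^sup>2 \<partial>\<nu> a) \<and>
      (\<forall>\<phi>. test_fun \<phi> \<longrightarrow> inner (\<Phi> \<phi> a) (v a) = (\<integral>x. inner (\<phi> x) (f a x) \<partial>\<nu> a))"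
    using cyclic_component[OF _ f] by (intro bchoice) blast
  then obtain v where v: "\<And>a. a \<in> A \<Longrightarrow> v a \<in> closure {\<Phi> \<phi> a |\<phi>. test_fun \<phi>}"
    "\<And>a. a \<in> A \<Longrightarrow> (norm (v a))\<^sup>2 = (\<integral>x. (norm (f a x))\<^sup>2 \<partial>\<nu> a)"
    "\<And>a \<phi>. a \<in> A \<Longrightarrow> test_fun \<phi> \<Longrightarrow> inner (\<Phi> \<phi> a) (v a) = (\<integral>x. inner (\<phi> x) (f a x) \<partial>\<nu> a)"
    by blast
  have orth: "inner (\<Phi> \<phi> b) (v a) = 0" if "a \<in> A" "b \<in> A" "a \<noteq> b" "test_fun \<phi>" for a b \<phi>
    using orthogonal_closure[OF v(1)[OF that(1)], of "\<Phi> \<phi> b"] \<Phi>_orthogonal that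
    by (simp add: inner_commute)
  have "pairwise (\<lambda>a b. orthogonal (v a) (v b)) A"
    unfolding pairwise_def orthogonal_def
    using orthogonal_closure[OF v(1)] orth by blast
  moreover have "(\<lambda>a. (norm (v a))\<^sup>2) summable_on A"
    using sum by (subst summable_on_cong[OF v(2)])
  ultimately obtain u where u: "(v has_sum u) A" "((\<lambda>a. (norm (v a))\<^sup>2) has_sum (norm u)\<^sup>2) A"
    by (rule orthogonal_summable_on)
  have "inner (\<Phi> \<phi> a) u = (\<integral>x. inner (\<phi> x) (f a x) \<partial>\<nu> a)" if a: "a \<in> A" and \<phi>: "test_fun \<phi>" for a \<phi>
  proof -
    have "((\<lambda>b. inner (\<Phi> \<phi> a) (v b)) has_sum inner (\<Phi> \<phi> a) u) A"
      using has_sum_bounded_linear[OF bounded_linear_inner_right u(1)] by (simp add: o_def)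
    then have "((\<lambda>b. inner (\<Phi> \<phi> a) (v b)) has_sum inner (\<Phi> \<phi> a) u) {a}"
      using a orth[OF _ a _ \<phi>] by (subst (asm) has_sum_cong_neutral[where T = "{a}"]) auto
    moreover have "((\<lambda>b. inner (\<Phi> \<phi> a) (v b)) has_sum inner (\<Phi> \<phi> a) (v a)) {a}"
      by (rule has_sum_finiteI) auto
    ultimately show ?thesis
      using has_sum_unique v(3)[OF a \<phi>] by metis
  qed
  then have "represents f u"
    using f by (simp add: represents_def)
  moreover have "((\<lambda>a. \<integral>x. (norm (f a x))\<^sup>2 \<partial>\<nu> a) has_sum (norm u)\<^sup>2) A"
    using u(2) by (subst (asm) has_sum_cong[OF v(2)])
  ultimately show thesis by (rule that)
qed

text \<open>Bessel only gives summability. The densities of u then synthesise a vector v for which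
  equality holds, and v = u because a vector is determined by its densities.\<close>

lemma Parseval:
  assumes f: "represents f u"
  shows "((\<lambda>a. \<integral>x. (norm (f a x))\<^sup>2 \<partial>\<nu> a) has_sum (norm u)\<^sup>2) A"
proof -
  have "bdd_above (sum (\<lambda>a. \<integral>x. (norm (f a x))\<^sup>2 \<partial>\<nu> a) ` {F. F \<subseteq> A \<and> finite F})"
    using Bessel_inequality[OF f] by (intro bdd_aboveI2) auto
  then have "(\<lambda>a. \<integral>x. (norm (f a x))\<^sup>2 \<partial>\<nu> a) summable_on A"
    by (intro nonneg_bdd_above_summable_on) auto
  with representsD(1)[OF f]
  obtain v where "represents f v" "((\<lambda>a. \<integral>x. (norm (f a x))\<^sup>2 \<partial>\<nu> a) has_sum (norm v)\<^sup>2) A"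
    by (rule represented_vector)
  then show ?thesis
    using represents_unique[OF f] by simp
qed

text \<open>u is projected onto the closed cyclic subspace of a. The approximating vectors come from
  test functions, which are Cauchy in L2 by the isometry; their Riesz-Fischer limit is the
  density.\<close>

lemma density:
  assumes a: "a \<in> A"
  shows "\<exists>f. f \<in> L2_functions (\<nu> a) \<and>
    (\<forall>\<phi>. test_fun \<phi> \<longrightarrow> inner (\<Phi> \<phi> a) u = (\<integral>x. inner (\<phi> x) (f x) \<partial>\<nu> a))"
proof -
  interpret finite_measure "\<nu> a" by (rule finite_measure_\<nu>)
  define K where "K = {\<Phi> \<phi> a |\<phi>. test_fun \<phi>}"
  have "subspace K"
  proof (rule subspaceI)
    show "0 \<in> K"
      unfolding K_def by (intro CollectI exI[of _ "\<lambda>_. 0"]) (simp add: \<Phi>_const L_zero)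
    show "x + y \<in> K" if "x \<in> K" "y \<in> K" for x y
    proof -
      obtain \<phi> \<psi> where "x = \<Phi> \<phi> a" "y = \<Phi> \<psi> a" "test_fun \<phi>" "test_fun \<psi>"
        using \<open>x \<in> K\<close> \<open>y \<in> K\<close> by (auto simp: K_def)
      then show ?thesis
        unfolding K_def
        by (intro CollectI exI[of _ "\<lambda>x. \<phi> x + \<psi> x"]) (simp add: \<Phi>_add test_fun_add plus_blinfun.rep_eq)
    qed
    show "r *\<^sub>R x \<in> K" if "x \<in> K" for r x
    proof -
      obtain \<phi> where \<phi>: "x = \<Phi> \<phi> a" "test_fun \<phi>"
        using \<open>x \<in> K\<close> by (auto simp: K_def)
      \<comment> \<open>A real scalar acts as a left multiplication and is thus absorbed into the
        test function.\<close>
      have "r *\<^sub>R x = L (r *\<^sub>R 1) x"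
        by (simp add: L_scaleR L_one scaleR_blinfun.rep_eq)
      then show ?thesis
        unfolding K_def using \<phi>
        by (intro CollectI exI[of _ "\<lambda>x. r *\<^sub>R 1 * \<phi> x"]) (simp only: \<Phi>_L test_fun_mult test_fun_const simp_thms)
    qed
  qed
  then obtain w v where w: "\<And>n. w n \<in> K" "w \<longlonglongrightarrow> v" and orth: "\<And>x. x \<in> K \<Longrightarrow> inner x (u - v) = 0"
    by (rule orthogonal_projection_sequence[where u = u]) (rule that)
  have "\<exists>s. \<forall>n. w n = \<Phi> (s n) a \<and> test_fun (s n)"
    using w(1) unfolding K_def by (intro choice) blast
  then obtain s where s: "\<And>n. w n = \<Phi> (s n) a" "\<And>n. test_fun (s n)"
    by blast
  have norm_diff: "(\<integral>x. (norm (s m x - s n x))\<^sup>2 \<partial>\<nu> a) = (norm (w m - w n))\<^sup>2" for m n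
    using norm_\<Phi>[OF a test_fun_diff[OF s(2) s(2)]] by (simp add: s \<Phi>_diff minus_blinfun.rep_eq)
  obtain f where f: "f \<in> borel_measurable (\<nu> a)" "integrable (\<nu> a) (\<lambda>x. (norm (f x))\<^sup>2)"
    "(\<lambda>n. \<integral>x. (norm (s n x - f x))\<^sup>2 \<partial>\<nu> a) \<longlonglongrightarrow> 0"
  proof (rule Riesz_Fischer)
    show "s n \<in> borel_measurable (\<nu> a)" "integrable (\<nu> a) (\<lambda>x. (norm (s n x))\<^sup>2)" for n
      using L2_functionsD[OF test_fun_L2[OF s(2)]] by auto
    fix e :: real assume "e > 0"
    have "Cauchy w" using w(2) by (rule LIMSEQ_imp_Cauchy)
    then obtain K where K: "\<And>m n. m \<ge> K \<Longrightarrow> n \<ge> K \<Longrightarrow> norm (w m - w n) < sqrt e"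
      using \<open>e > 0\<close> unfolding Cauchy_def dist_norm by (meson real_sqrt_gt_zero)
    have "(norm (w m - w n))\<^sup>2 \<le> e" if "m \<ge> K" "n \<ge> K" for m n
      using power_mono[OF less_imp_le[OF K[OF that]] norm_ge_zero, of 2] \<open>e > 0\<close> by simp
    then show "\<exists>N. \<forall>m\<ge>N. \<forall>n\<ge>N. (\<integral>x. (norm (s m x - s n x))\<^sup>2 \<partial>\<nu> a) \<le> e"
      unfolding norm_diff by blast
  qed
  have "inner (\<Phi> \<phi> a) u = (\<integral>x. inner (\<phi> x) (f x) \<partial>\<nu> a)" if \<phi>: "test_fun \<phi>" for \<phi>
  proof -
    have "(\<lambda>n. inner (\<Phi> \<phi> a) (w n)) \<longlonglongrightarrow> (\<integral>x. inner (\<phi> x) (f x) \<partial>\<nu> a)"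
      unfolding s inner_\<Phi>_\<Phi>[OF \<phi> s(2) A_intertwines[OF a]]
      by (intro L2_tendsto_inner L2_functionsD test_fun_L2 \<phi> s f)
    moreover have "(\<lambda>n. inner (\<Phi> \<phi> a) (w n)) \<longlonglongrightarrow> inner (\<Phi> \<phi> a) v"
      by (intro tendsto_inner tendsto_const w)
    moreover have "inner (\<Phi> \<phi> a) (u - v) = 0"
      using \<phi> by (intro orth) (auto simp: K_def)
    ultimately show ?thesis
      using LIMSEQ_unique by (fastforce simp: inner_diff_right)
  qed
  then show ?thesis
    using f by (intro exI[of _ f]) (simp add: L2_functions_def)
qed

lemma representation_exists: "\<exists>f. represents f u"
proof -
  have "\<exists>f. \<forall>a\<in>A. f a \<in> L2_functions (\<nu> a) \<and>
      (\<forall>\<phi>. test_fun \<phi> \<longrightarrow> inner (\<Phi> \<phi> a) u = (\<integral>x. inner (\<phi> x) (f a x) \<partial>\<nu> a))"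
    by (intro bchoice ballI density)
  then show ?thesis
    by (auto simp: represents_def)
qed

end

section \<open>The isometry onto the sum of $L^2$ spaces\<close>

lemma ae_class_eqI:
  assumes "AE x in M. f x = g x"
  shows "ae_class M f = ae_class M g"
proof -
  have "(AE x in M. f x = h x) \<longleftrightarrow> (AE x in M. g x = h x)" for h
    by (rule eventually_subst) (use assms in eventually_elim, simp)
  then show ?thesis by (simp add: ae_class_def)
qed

lemma ae_class_self: "f \<in> borel_measurable M \<Longrightarrow> f \<in> ae_class M f"
  by (simp add: ae_class_def)

lemma ae_class_eqD: "g \<in> borel_measurable M \<Longrightarrow> ae_class M f = ae_class M g \<Longrightarrow> AE x in M. f x = g x"
  using ae_class_self[of g M] by (auto simp: ae_class_def)

text \<open>The product evaluates a chosen representative, which agrees with f almost everywhere and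
  so has the same integral.\<close>

lemma qprod_L2_self:
  assumes f: "f \<in> L2_functions M"
  shows "qprod (L2 M) (ae_class M f) (ae_class M f) = (\<integral>x. (norm (f x))\<^sup>2 \<partial>M) *\<^sub>R 1"
proof -
  define g where "g = (SOME g. g \<in> ae_class M f)"
  have "g \<in> ae_class M f"
    unfolding g_def using ae_class_self[OF L2_functionsD(1)[OF f]] by (rule someI[where P = "\<lambda>g. g \<in> ae_class M f"])
  then have g [measurable]: "g \<in> borel_measurable M" and ae: "AE x in M. f x = g x"
    by (auto simp: ae_class_def)
  note [measurable] = L2_functionsD(1)[OF f]
  have int: "integrable M (\<lambda>x. (norm (g x))\<^sup>2)"
    using L2_functionsD(2)[OF f] ae by (subst integrable_cong_AE[of _ _ "\<lambda>x. (norm (f x))\<^sup>2"]) auto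
  have "qprod (L2 M) (ae_class M f) (ae_class M f) = (\<integral>x. (norm (g x))\<^sup>2 *\<^sub>R 1 \<partial>M)"
    by (simp add: L2_def g_def[symmetric] qcnj_mult_self power2_norm_eq_inner)
  also have "\<dots> = (\<integral>x. (norm (g x))\<^sup>2 \<partial>M) *\<^sub>R 1"
    using int by simp
  also have "(\<integral>x. (norm (g x))\<^sup>2 \<partial>M) = (\<integral>x. (norm (f x))\<^sup>2 \<partial>M)"
    using ae by (intro integral_cong_AE) auto
  finally show ?thesis .
qed

lemma qnorm_L2: "f \<in> L2_functions M \<Longrightarrow> (qnorm (L2 M) (ae_class M f))\<^sup>2 = (\<integral>x. (norm (f x))\<^sup>2 \<partial>M)"
  by (simp add: qnorm_def qprod_L2_self)

text \<open>All pairs of representatives give the same class, so the union in the definition is one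
  over a nonempty family of equal sets.\<close>

lemma qadd_L2:
  assumes "f \<in> borel_measurable M" "g \<in> borel_measurable M"
  shows "qadd (L2 M) (ae_class M f) (ae_class M g) = ae_class M (\<lambda>x. f x + g x)"
proof -
  have "ae_class M (\<lambda>x. f' x + g' x) = ae_class M (\<lambda>x. f x + g x)"
    if "f' \<in> ae_class M f" "g' \<in> ae_class M g" for f' g'
  proof (rule ae_class_eqI)
    have "AE x in M. f x = f' x" "AE x in M. g x = g' x"
      using that by (simp_all add: ae_class_def)
    then show "AE x in M. f' x + g' x = f x + g x"
      by eventually_elim simp
  qed
  moreover have "ae_class M f \<noteq> {}" "ae_class M g \<noteq> {}"
    using ae_class_self assms by blast+
  ultimately show ?thesis
    by (simp add: L2_def cong: SUP_cong)
qed

lemma qscale_L2: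
  assumes "f \<in> borel_measurable M"
  shows "qscale (L2 M) (ae_class M f) q = ae_class M (\<lambda>x. f x * q)"
proof -
  have "ae_class M (\<lambda>x. f' x * q) = ae_class M (\<lambda>x. f x * q)" if "f' \<in> ae_class M f" for f'
  proof (rule ae_class_eqI)
    have "AE x in M. f x = f' x"
      using that by (simp add: ae_class_def)
    then show "AE x in M. f' x * q = f x * q"
      by eventually_elim simp
  qed
  moreover have "ae_class M f \<noteq> {}"
    using ae_class_self assms by blast
  ultimately show ?thesis
    by (simp add: L2_def cong: SUP_cong)
qed

lemma oplus_L2_carrier:
  assumes f: "\<And>a. a \<in> A \<Longrightarrow> f a \<in> L2_functions (\<mu> a)"
  shows "oplus A \<mu> f \<in> qcarrier (hilbert_sum A (\<lambda>a. L2 (\<mu> a))) \<longleftrightarrow>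
    (\<lambda>a. \<integral>x. (norm (f a x))\<^sup>2 \<partial>\<mu> a) summable_on A"
proof -
  have "(\<lambda>a. (qnorm (L2 (\<mu> a)) (oplus A \<mu> f a))\<^sup>2) summable_on A \<longleftrightarrow>
      (\<lambda>a. \<integral>x. (norm (f a x))\<^sup>2 \<partial>\<mu> a) summable_on A"
    using f by (intro summable_on_cong) (simp add: oplus_def qnorm_L2)
  moreover have "oplus A \<mu> f \<in> (\<Pi>\<^sub>E a\<in>A. qcarrier (L2 (\<mu> a)))"
    using f by (auto simp: oplus_def L2_def)
  ultimately show ?thesis
    by (simp add: hilbert_sum_def)
qed

lemma L2_carrier_representative:
  assumes "x \<in> qcarrier (hilbert_sum A (\<lambda>a. L2 (\<mu> a)))"
  obtains f where "\<And>a. a \<in> A \<Longrightarrow> f a \<in> L2_functions (\<mu> a)" "x = oplus A \<mu> f"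
proof -
  have x: "x \<in> (\<Pi>\<^sub>E a\<in>A. ae_class (\<mu> a) ` L2_functions (\<mu> a))"
    using assms by (simp add: hilbert_sum_def L2_def)
  then have "\<exists>f. \<forall>a\<in>A. f a \<in> L2_functions (\<mu> a) \<and> x a = ae_class (\<mu> a) (f a)"
    by (intro bchoice) (auto simp: PiE_iff)
  then obtain f where f: "\<forall>a\<in>A. f a \<in> L2_functions (\<mu> a) \<and> x a = ae_class (\<mu> a) (f a)"
    by blast
  then have "x = oplus A \<mu> f"
    using x by (auto simp: oplus_def fun_eq_iff PiE_iff extensional_def)
  with f show thesis by (intro that) auto
qed

context cyclic_decomposition
begin

text \<open>The choice of densities is free only up to null sets of each measure, so it disappears
  on passing to classes.\<close>

definition V :: "'a \<Rightarrow> 'a \<Rightarrow> (quat \<Rightarrow> quat) set"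
  where "V u = oplus A \<nu> (SOME f. represents f u)"

lemma V_represents: "represents (SOME f. represents f u) u"
  using representation_exists by (rule someI_ex)

lemma V_eq_oplus:
  assumes "represents f u"
  shows "V u = oplus A \<nu> f"
  unfolding V_def oplus_def
  using represents_AE_unique[OF V_represents assms] by (intro restrict_ext ae_class_eqI)

lemma represents_if_V_eq:
  assumes eq: "V u = oplus A \<nu> f" and f: "\<And>a. a \<in> A \<Longrightarrow> f a \<in> L2_functions (\<nu> a)"
  shows "represents f u"
proof (rule represents_cong[OF V_represents f])
  fix a assume a: "a \<in> A"
  then have "ae_class (\<nu> a) ((SOME f. represents f u) a) = ae_class (\<nu> a) (f a)"
    using fun_cong[OF eq, of a] by (simp add: V_def oplus_def)
  then show "AE x in \<nu> a. (SOME f. represents f u) a x = f a x"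
    by (rule ae_class_eqD[OF L2_functionsD(1)[OF f[OF a]]])
qed auto

lemma inj_V: "inj V"
proof (rule injI)
  fix u v assume "V u = V v"
  then have "V u = oplus A \<nu> (SOME f. represents f v)"
    by (simp add: V_def)
  then have "represents (SOME f. represents f v) u"
    by (rule represents_if_V_eq) (rule representsD[OF V_represents])
  then show "u = v"
    using V_represents represents_unique by blast
qed

lemma carrier_represents:
  assumes "oplus A \<nu> f \<in> qcarrier (hilbert_sum A (\<lambda>a. L2 (\<nu> a)))"
    and f: "\<And>a. a \<in> A \<Longrightarrow> f a \<in> L2_functions (\<nu> a)"
  obtains u where "represents f u"
  using assms represented_vector[OF f] by (auto simp: oplus_L2_carrier)

text \<open>The Parseval identity puts V u into the Hilbert sum; conversely, densities with summable
  squared norms synthesise a preimage.\<close>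

lemma range_V: "range V = qcarrier (hilbert_sum A (\<lambda>a. L2 (\<nu> a)))"
proof (intro equalityI subsetI)
  fix x assume "x \<in> range V"
  then obtain u where "x = V u" by blast
  then show "x \<in> qcarrier (hilbert_sum A (\<lambda>a. L2 (\<nu> a)))"
    using Parseval[OF V_represents[of u]] representsD(1)[OF V_represents]
    by (auto simp: V_def oplus_L2_carrier summable_on_def)
next
  fix x assume x: "x \<in> qcarrier (hilbert_sum A (\<lambda>a. L2 (\<nu> a)))"
  then obtain f where f: "\<And>a. a \<in> A \<Longrightarrow> f a \<in> L2_functions (\<nu> a)" "x = oplus A \<nu> f"
    by (rule L2_carrier_representative) (rule that)
  obtain u where "represents f u"
    using x f(1) unfolding f(2) by (rule carrier_represents)
  then have "x = V u"
    using V_eq_oplus f(2) by simp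
  then show "x \<in> range V" by (rule range_eqI)
qed

lemma qisometry_V: "qisometry type_qspace (hilbert_sum A (\<lambda>a. L2 (\<nu> a))) V"
  unfolding qisometry_def
proof (intro conjI ballI allI)
  show "bij_betw V (qcarrier type_qspace) (qcarrier (hilbert_sum A (\<lambda>a. L2 (\<nu> a))))"
    using inj_V range_V by (simp add: bij_betw_def type_qspace_def)
  fix u v :: 'a and q
  define f where "f = (SOME f. represents f u)"
  define g where "g = (SOME g. represents g v)"
  have f: "represents f u" and g: "represents g v"
    unfolding f_def g_def by (rule V_represents)+
  have fg: "f a \<in> borel_measurable (\<nu> a)" "g a \<in> borel_measurable (\<nu> a)" if "a \<in> A" for a
    using L2_functionsD(1) representsD(1) f g that by blast+
  show "V (qadd type_qspace u v) = qadd (hilbert_sum A (\<lambda>a. L2 (\<nu> a))) (V u) (V v)"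
    using V_eq_oplus[OF represents_add[OF f g]] fg
    by (auto simp: type_qspace_def V_eq_oplus[OF f] V_eq_oplus[OF g] hilbert_sum_def oplus_def
        qadd_L2 intro!: restrict_ext)
  show "V (qscale type_qspace u q) = qscale (hilbert_sum A (\<lambda>a. L2 (\<nu> a))) (V u) q"
    using V_eq_oplus[OF represents_scaleQ[OF f]] fg
    by (auto simp: type_qspace_def V_eq_oplus[OF f] hilbert_sum_def oplus_def
        qscale_L2 intro!: restrict_ext)
  show "qnorm (hilbert_sum A (\<lambda>a. L2 (\<nu> a))) (V u) = qnorm type_qspace u"
  proof -
    \<comment> \<open>The product of the Hilbert sum is a quaternion-valued infinite sum, so the
      real Parseval sum is carried over by r \<mapsto> r 1.\<close>
    have "((\<lambda>a. (\<integral>x. (norm (f a x))\<^sup>2 \<partial>\<nu> a) *\<^sub>R (1::quat)) has_sum (norm u)\<^sup>2 *\<^sub>R 1) A"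
      using has_sum_bounded_linear[OF bounded_linear_scaleR_left[of "1::quat"] Parseval[OF f]] by (simp add: o_def)
    then have "((\<lambda>a. qprod (L2 (\<nu> a)) (V u a) (V u a)) has_sum (norm u)\<^sup>2 *\<^sub>R 1) A"
      using representsD(1)[OF f]
      by (subst has_sum_cong) (auto simp: V_eq_oplus[OF f] oplus_def qprod_L2_self)
    then have "qprod (hilbert_sum A (\<lambda>a. L2 (\<nu> a))) (V u) (V u) = (norm u)\<^sup>2 *\<^sub>R 1"
      by (simp add: hilbert_sum_def infsumI)
    then show ?thesis
      by (simp add: qnorm_type_qspace) (simp add: qnorm_def)
  qed
qed

lemma V_\<Phi>:
  assumes "test_fun \<phi>" and f: "\<And>a. a \<in> A \<Longrightarrow> f a \<in> L2_functions (\<nu> a)"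
    and "oplus A \<nu> f \<in> qcarrier (hilbert_sum A (\<lambda>a. L2 (\<nu> a)))"
  shows "V (\<Phi> \<phi> (inv V (oplus A \<nu> f))) = oplus A \<nu> (\<lambda>a x. \<phi> x * f a x)"
proof -
  obtain u where u: "represents f u"
    using assms(3) f by (rule carrier_represents)
  have "inv V (oplus A \<nu> f) = u"
    using inj_V by (simp add: V_eq_oplus[OF u, symmetric])
  then show ?thesis
    using V_eq_oplus[OF represents_\<Phi>[OF u assms(1)]] by simp
qed

end

theorem theoremB:
  fixes T :: "'h::quaternionic_hilbert \<Rightarrow>\<^sub>L 'h"
    and P :: "quat set \<Rightarrow> ('h \<Rightarrow>\<^sub>L 'h)"
    and L :: "quat \<Rightarrow> ('h \<Rightarrow>\<^sub>L 'h)"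
    and \<iota> :: quat and \<Gamma> :: "quat set"
  assumes "\<iota> \<in> imaginary_units"
    and "T \<in> qops" and "qnormal T"
    and "iqpvm \<iota> P L"
    and "\<Gamma> = qsupp \<iota> P" and "bounded \<Gamma>"
    and "T = iq_integral \<iota> P L (\<lambda>x. x)"
  shows "\<exists>(A :: 'h set) (\<nu> :: 'h \<Rightarrow> quat measure) (V :: 'h \<Rightarrow> 'h \<Rightarrow> (quat \<Rightarrow> quat) set).
    (\<forall>\<alpha>\<in>A. finite_measure (\<nu> \<alpha>) \<and> space (\<nu> \<alpha>) = \<Gamma> \<and>
      sets (\<nu> \<alpha>) = sets (restrict_space borel \<Gamma>)) \<and>
    qisometry type_qspace (hilbert_sum A (\<lambda>\<alpha>. L2 (\<nu> \<alpha>))) V \<and>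
    (\<forall>\<phi> f. \<phi> \<in> borel_measurable (restrict_space borel \<Gamma>) \<longrightarrow> bounded (\<phi> ` \<Gamma>) \<longrightarrow>
      (\<forall>\<alpha>\<in>A. f \<alpha> \<in> L2_functions (\<nu> \<alpha>)) \<longrightarrow>
      oplus A \<nu> f \<in> qcarrier (hilbert_sum A (\<lambda>\<alpha>. L2 (\<nu> \<alpha>))) \<longrightarrow>
      V (blinfun_apply (iq_integral \<iota> P L \<phi>) (inv V (oplus A \<nu> f))) =
        oplus A \<nu> (\<lambda>\<alpha> x. \<phi> x * f \<alpha> x)) \<and>
    (\<forall>q f. (\<forall>\<alpha>\<in>A. f \<alpha> \<in> L2_functions (\<nu> \<alpha>)) \<longrightarrow>
      oplus A \<nu> f \<in> qcarrier (hilbert_sum A (\<lambda>\<alpha>. L2 (\<nu> \<alpha>))) \<longrightarrow>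
      V (blinfun_apply (L q) (inv V (oplus A \<nu> f))) =
        oplus A \<nu> (\<lambda>\<alpha> x. q * f \<alpha> x))"
proof -
  interpret intertwining_pvm \<iota> P L
    by unfold_locales fact
  \<comment> \<open>The total family of cyclic vectors is itself the index set of the sum.\<close>
  obtain A where A: "cyclic_family A"
    "\<And>w. (\<And>a \<phi>. a \<in> A \<Longrightarrow> test_fun \<phi> \<Longrightarrow> inner (\<Phi> \<phi> a) w = 0) \<Longrightarrow> w = 0"
    using total_cyclic_family by metis
  interpret cyclic_decomposition \<iota> P L A
    by unfold_locales (fact A)+
  show ?thesis
  proof (intro exI conjI allI impI ballI)
    show "finite_measure (\<nu> \<alpha>)" "space (\<nu> \<alpha>) = \<Gamma>" "sets (\<nu> \<alpha>) = sets (restrict_space borel \<Gamma>)" for \<alpha>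
      using \<open>\<Gamma> = qsupp \<iota> P\<close> by (simp_all add: finite_measure_\<nu>)
    show "qisometry type_qspace (hilbert_sum A (\<lambda>\<alpha>. L2 (\<nu> \<alpha>))) V"
      by (rule qisometry_V)
    fix f assume f: "\<forall>\<alpha>\<in>A. f \<alpha> \<in> L2_functions (\<nu> \<alpha>)"
      "oplus A \<nu> f \<in> qcarrier (hilbert_sum A (\<lambda>\<alpha>. L2 (\<nu> \<alpha>)))"
    show "V (iq_integral \<iota> P L \<phi> (inv V (oplus A \<nu> f))) = oplus A \<nu> (\<lambda>\<alpha> x. \<phi> x * f \<alpha> x)"
      if "\<phi> \<in> borel_measurable (restrict_space borel \<Gamma>)" "bounded (\<phi> ` \<Gamma>)" for \<phi>
      using that f \<open>\<Gamma> = qsupp \<iota> P\<close> by (intro V_\<Phi>) (auto simp: test_fun_def)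
    \<comment> \<open>The case of the constant function q, whose calculus is
      \<open>L q\<close>.\<close>
    show "V (L q (inv V (oplus A \<nu> f))) = oplus A \<nu> (\<lambda>\<alpha> x. q * f \<alpha> x)" for q
      using V_\<Phi>[OF test_fun_const, of f q] f by (simp add: \<Phi>_const)
  qed
qed

end
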